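(* Let $S$ be a countable semigroup, and let $\sigma$ be a locally compact Hausdorff topology on $S$ making $S$ a semitopological semigroup, such that for each $s\in S$ and each $\sigma$-compact-as-a-subspace (i.e. compact in $\sigma$) set $L\subseteq S$, the sets $\{t\in S: st\in L\}$ and $\{t\in S: ts\in L\}$ are compact in $\sigma$. Then $C_0(S,\sigma)$ is a predual for $\ell^1(S)$.
   Context: For a semigroup $S$ (discrete), $\ell^1(S)$ is the complex convolution Banach algebra with standard unit vectors $(\delta_s)_{s\in S}$ and product determined by $\delta_s\delta_t=\delta_{st}$; its dual is identified with $\ell^\infty(S)$, with bimodule actions $(\delta_s\cdot f)(t)=f(ts)$ and $(f\cdot\delta_s)(t)=f(st)$. A predual of a Banach algebra $A$ is a norm-closed sub-bimodule $E\subseteq A^*$ which is a Banach space predual of $A$, i.e. the canonical map $A\to E^*$, $a\mapsto(\mu\mapsto\mu(a))$, is a linear isomorphism (bijective and bicontinuous, not necessarily isometric). $C_0(S,\sigma)$ is the space of $\sigma$-continuous complex functions on $S$ vanishing at infinity, regarded as a subspace of $\ell^\infty(S)$. A semigroup carrying a topology is semitopological if its product is separately continuous. *)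

theory Defs
  imports "HOL-Analysis.Analysis"
begin

section \<open>Complex Banach algebras, their duals and preduals\<close>

class complex_banach_algebra = real_normed_algebra + banach +
  fixes scaleC :: "complex \<Rightarrow> 'a \<Rightarrow> 'a"  (infixr "*\<^sub>C" 75)
  assumes scaleC_add_right: "c *\<^sub>C (x + y) = c *\<^sub>C x + c *\<^sub>C y"
    and scaleC_add_left: "(c + d) *\<^sub>C x = c *\<^sub>C x + d *\<^sub>C x"
    and scaleC_scaleC: "c *\<^sub>C d *\<^sub>C x = (c * d) *\<^sub>C x"
    and scaleC_of_real: "of_real r *\<^sub>C x = r *\<^sub>R x"
    and mult_scaleC_left: "(c *\<^sub>C x) * y = c *\<^sub>C (x * y)"
    and mult_scaleC_right: "x * (c *\<^sub>C y) = c *\<^sub>C (x * y)"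
    and norm_scaleC: "norm (c *\<^sub>C x) = norm c * norm x"

text \<open>The type \<open>'b \<Rightarrow>\<^sub>L complex\<close> consists of the bounded \<^emph>\<open>real\<close>-linear maps; the dual
  of the complex space is its subspace of complex-linear maps, with the same operator norm.\<close>

definition cdual :: "('b::complex_banach_algebra \<Rightarrow>\<^sub>L complex) set" where
  "cdual = {\<phi>. \<forall>c x. blinfun_apply \<phi> (c *\<^sub>C x) = c * blinfun_apply \<phi> x}"

definition scale_functional ::
    "complex \<Rightarrow> ('b::complex_banach_algebra \<Rightarrow>\<^sub>L complex) \<Rightarrow> ('b \<Rightarrow>\<^sub>L complex)" where
  "scale_functional c \<phi> = blinfun_mult_right c o\<^sub>L \<phi>"

definition lact :: "'b::complex_banach_algebra \<Rightarrow> ('b \<Rightarrow>\<^sub>L complex) \<Rightarrow> ('b \<Rightarrow>\<^sub>L complex)" where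
  "lact a \<phi> = \<phi> o\<^sub>L blinfun_mult_left a"

definition ract :: "('b::complex_banach_algebra \<Rightarrow>\<^sub>L complex) \<Rightarrow> 'b \<Rightarrow> ('b \<Rightarrow>\<^sub>L complex)" where
  "ract \<phi> a = \<phi> o\<^sub>L blinfun_mult_right a"

lemma scale_functional_apply [simp]: "scale_functional c \<phi> x = c * \<phi> x"
  by (simp add: scale_functional_def)

lemma lact_apply [simp]: "lact a \<phi> x = \<phi> (x * a)"
  by (simp add: lact_def)

lemma ract_apply [simp]: "ract \<phi> a x = \<phi> (a * x)"
  by (simp add: ract_def)

definition sub_bimodule :: "('b::complex_banach_algebra \<Rightarrow>\<^sub>L complex) set \<Rightarrow> bool" where
  "sub_bimodule E \<longleftrightarrow> E \<subseteq> cdual \<and> 0 \<in> E \<and> (\<forall>\<mu>\<in>E. \<forall>\<nu>\<in>E. \<mu> + \<nu> \<in> E) \<and>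
     (\<forall>c. \<forall>\<mu>\<in>E. scale_functional c \<mu> \<in> E) \<and>
     (\<forall>a. \<forall>\<mu>\<in>E. lact a \<mu> \<in> E \<and> ract \<mu> a \<in> E)"

text \<open>The dual \<open>E\<^sup>*\<close> of a subspace \<open>E\<close>; its elements are functions on \<open>E\<close>, hence
  extensional, and its topology is that of the operator norm.\<close>

definition subspace_dual ::
    "('b::complex_banach_algebra \<Rightarrow>\<^sub>L complex) set \<Rightarrow> (('b \<Rightarrow>\<^sub>L complex) \<Rightarrow> complex) set" where
  "subspace_dual E = {g \<in> extensional E.
     (\<forall>\<mu>\<in>E. \<forall>\<nu>\<in>E. g (\<mu> + \<nu>) = g \<mu> + g \<nu>) \<and>
     (\<forall>c. \<forall>\<mu>\<in>E. g (scale_functional c \<mu>) = c * g \<mu>) \<and>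
     (\<exists>K. \<forall>\<mu>\<in>E. norm (g \<mu>) \<le> K * norm \<mu>)}"

text \<open>The absolute value has no effect on \<open>E\<^sup>*\<close>; it makes the function nonnegative
  everywhere, as \<^locale>\<open>Metric_space\<close> requires also off the carrier.\<close>

definition subspace_dual_dist :: "('b::complex_banach_algebra \<Rightarrow>\<^sub>L complex) set \<Rightarrow>
    (('b \<Rightarrow>\<^sub>L complex) \<Rightarrow> complex) \<Rightarrow> (('b \<Rightarrow>\<^sub>L complex) \<Rightarrow> complex) \<Rightarrow> real" where
  "subspace_dual_dist E g h = \<bar>SUP \<mu>\<in>{\<mu>\<in>E. norm \<mu> \<le> 1}. norm (g \<mu> - h \<mu>)\<bar>"

definition subspace_dual_topology ::
    "('b::complex_banach_algebra \<Rightarrow>\<^sub>L complex) set \<Rightarrow> (('b \<Rightarrow>\<^sub>L complex) \<Rightarrow> complex) topology" where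
  "subspace_dual_topology E = Metric_space.mtopology (subspace_dual E) (subspace_dual_dist E)"

definition canonical_map ::
    "('b::complex_banach_algebra \<Rightarrow>\<^sub>L complex) set \<Rightarrow> 'b \<Rightarrow> (('b \<Rightarrow>\<^sub>L complex) \<Rightarrow> complex)" where
  "canonical_map E a = restrict (\<lambda>\<mu>. blinfun_apply \<mu> a) E"

text \<open>The canonical map is linear by construction, so being a linear isomorphism amounts to
  being a bijection onto \<open>E\<^sup>*\<close> that is continuous with continuous inverse.\<close>

definition is_predual :: "('b::complex_banach_algebra \<Rightarrow>\<^sub>L complex) set \<Rightarrow> bool" where
  "is_predual E \<longleftrightarrow> sub_bimodule E \<and> closed E \<and>
     homeomorphic_map euclidean (subspace_dual_topology E) (canonical_map E)"

lemma norm_scale_functional: "norm (scale_functional c \<mu>) \<le> norm c * norm \<mu>"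
  by (rule norm_blinfun_bound)
    (auto simp: norm_mult mult.assoc intro!: mult_left_mono norm_blinfun)

lemma subspace_dual_dist_bdd:
  assumes "g \<in> subspace_dual E" "h \<in> subspace_dual E"
  shows "bdd_above ((\<lambda>\<mu>. norm (g \<mu> - h \<mu>)) ` {\<mu>\<in>E. norm \<mu> \<le> 1})"
proof -
  obtain K L where K: "\<forall>\<mu>\<in>E. norm (g \<mu>) \<le> K * norm \<mu>" and L: "\<forall>\<mu>\<in>E. norm (h \<mu>) \<le> L * norm \<mu>"
    using assms by (auto simp: subspace_dual_def)
  have "norm (g \<mu> - h \<mu>) \<le> \<bar>K\<bar> + \<bar>L\<bar>" if "\<mu> \<in> E" "norm \<mu> \<le> 1" for \<mu>
  proof -
    have "norm (g \<mu>) \<le> \<bar>K\<bar> * 1"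
      by (rule order_trans[OF bspec[OF K that(1)]]) (rule mult_mono, use that in auto)
    moreover have "norm (h \<mu>) \<le> \<bar>L\<bar> * 1"
      by (rule order_trans[OF bspec[OF L that(1)]]) (rule mult_mono, use that in auto)
    ultimately show ?thesis
      using norm_triangle_ineq4[of "g \<mu>" "h \<mu>"] by linarith
  qed
  then show ?thesis by (auto intro!: bdd_aboveI2)
qed

lemma Metric_space_subspace_dual:
  assumes "sub_bimodule E"
  shows "Metric_space (subspace_dual E) (subspace_dual_dist E)"
proof
  let ?B = "{\<mu>\<in>E. norm \<mu> \<le> 1}"
  have ne: "0 \<in> ?B" using assms by (auto simp: sub_bimodule_def)
  have upper: "norm (g \<mu> - h \<mu>) \<le> (SUP \<mu>\<in>?B. norm (g \<mu> - h \<mu>))"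
    if "g \<in> subspace_dual E" "h \<in> subspace_dual E" "\<mu> \<in> ?B" for g h \<mu>
    using cSUP_upper[OF that(3) subspace_dual_dist_bdd[OF that(1,2)]] .
  have eq: "subspace_dual_dist E g h = (SUP \<mu>\<in>?B. norm (g \<mu> - h \<mu>))"
    if "g \<in> subspace_dual E" "h \<in> subspace_dual E" for g h
    unfolding subspace_dual_dist_def
    by (rule abs_of_nonneg, rule order_trans[OF norm_ge_zero upper[OF that ne]])
  show "0 \<le> subspace_dual_dist E g h" for g h
    by (simp add: subspace_dual_dist_def)
  show "subspace_dual_dist E g h = subspace_dual_dist E h g" for g h
    by (simp add: subspace_dual_dist_def norm_minus_commute)
  show "subspace_dual_dist E g h = 0 \<longleftrightarrow> g = h"
    if gh: "g \<in> subspace_dual E" "h \<in> subspace_dual E" for g h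
  proof
    assume 0: "subspace_dual_dist E g h = 0"
    show "g = h"
    proof (rule extensionalityI[of _ E])
      show "g \<in> extensional E" "h \<in> extensional E"
        using gh by (auto simp: subspace_dual_def)
      fix \<mu> assume \<mu>: "\<mu> \<in> E"
      define c where "c = complex_of_real (1 / (norm \<mu> + 1))"
      have n: "norm c = 1 / (norm \<mu> + 1)" and c0: "c \<noteq> 0"
        using norm_ge_zero[of \<mu>] unfolding c_def norm_of_real of_real_eq_0_iff
        by (simp_all add: add_nonneg_eq_0_iff)
      have "norm (scale_functional c \<mu>) \<le> 1"
        by (rule order_trans[OF norm_scale_functional]) (simp add: n divide_le_eq_1 add_nonneg_pos)
      then have "scale_functional c \<mu> \<in> ?B"
        using assms \<mu> by (auto simp: sub_bimodule_def)
      then have "norm (g (scale_functional c \<mu>) - h (scale_functional c \<mu>)) \<le> 0"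
        using upper[OF gh] eq[OF gh] 0 by fastforce
      moreover have "g (scale_functional c \<mu>) = c * g \<mu>" "h (scale_functional c \<mu>) = c * h \<mu>"
        using gh \<mu> by (auto simp: subspace_dual_def)
      ultimately show "g \<mu> = h \<mu>" using c0 by simp
    qed
  next
    assume "g = h"
    moreover have "(SUP \<mu>\<in>?B. 0::real) = 0"
      using ne by (intro cSUP_const) auto
    ultimately show "subspace_dual_dist E g h = 0"
      by (simp add: subspace_dual_dist_def)
  qed
  show "subspace_dual_dist E f h \<le> subspace_dual_dist E f g + subspace_dual_dist E g h"
    if fgh: "f \<in> subspace_dual E" "g \<in> subspace_dual E" "h \<in> subspace_dual E" for f g h
    unfolding eq[OF fgh(1,3)] eq[OF fgh(1,2)] eq[OF fgh(2,3)]
  proof (rule cSUP_least)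
    show "?B \<noteq> {}" using ne by blast
    fix \<mu> assume \<mu>: "\<mu> \<in> ?B"
    have "norm (f \<mu> - h \<mu>) \<le> norm (f \<mu> - g \<mu>) + norm (g \<mu> - h \<mu>)"
      by (metis norm_triangle_sub norm_diff_triangle_le order_refl)
    then show "norm (f \<mu> - h \<mu>) \<le> (SUP \<mu>\<in>?B. norm (f \<mu> - g \<mu>)) + (SUP \<mu>\<in>?B. norm (g \<mu> - h \<mu>))"
      using upper[OF fgh(1,2) \<mu>] upper[OF fgh(2,3) \<mu>] by linarith
  qed
qed


section \<open>The convolution algebra of a semigroup\<close>

typedef 'a ell1 = "{a :: 'a \<Rightarrow> complex. (\<lambda>s. norm (a s)) summable_on UNIV}"
  morphisms ell1_apply Abs_ell1
  by (rule exI[of _ "\<lambda>_. 0"]) simp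

setup_lifting type_definition_ell1

lemma ell1_eqI: "(\<And>s. ell1_apply a s = ell1_apply b s) \<Longrightarrow> a = b"
  by transfer auto

lemma ell1_abs_summable: "(\<lambda>s. norm (ell1_apply a s)) summable_on UNIV"
  by transfer

instantiation ell1 :: (type) real_normed_vector
begin

lift_definition zero_ell1 :: "'a ell1" is "\<lambda>_. 0" by simp

lift_definition plus_ell1 :: "'a ell1 \<Rightarrow> 'a ell1 \<Rightarrow> 'a ell1" is "\<lambda>a b s. a s + b s"
  by (rule Infinite_Sum.abs_summable_on_comparison_test'[OF summable_on_add norm_triangle_ineq])

lift_definition uminus_ell1 :: "'a ell1 \<Rightarrow> 'a ell1" is "\<lambda>a s. - a s"
  by simp

lift_definition minus_ell1 :: "'a ell1 \<Rightarrow> 'a ell1 \<Rightarrow> 'a ell1" is "\<lambda>a b s. a s - b s"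
  by (rule Infinite_Sum.abs_summable_on_comparison_test'[OF summable_on_add norm_triangle_ineq4])

lift_definition scaleR_ell1 :: "real \<Rightarrow> 'a ell1 \<Rightarrow> 'a ell1" is "\<lambda>r a s. r *\<^sub>R a s"
  by (simp add: summable_on_cmult_right)

lift_definition norm_ell1 :: "'a ell1 \<Rightarrow> real" is "\<lambda>a. \<Sum>\<^sub>\<infinity>s. norm (a s)" .

definition dist_ell1 :: "'a ell1 \<Rightarrow> 'a ell1 \<Rightarrow> real"
  where "dist_ell1 a b = norm (a - b)"

definition sgn_ell1 :: "'a ell1 \<Rightarrow> 'a ell1"
  where "sgn_ell1 a = inverse (norm a) *\<^sub>R a"

definition uniformity_ell1 :: "('a ell1 \<times> 'a ell1) filter"
  where "uniformity_ell1 = (INF e\<in>{0<..}. principal {(x, y). dist x y < e})"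

definition open_ell1 :: "'a ell1 set \<Rightarrow> bool"
  where "open_ell1 U = (\<forall>x\<in>U. \<forall>\<^sub>F (x', y) in uniformity. x' = x \<longrightarrow> y \<in> U)"

instance
proof
  fix a b c :: "'a ell1" and r q :: real and U :: "'a ell1 set"
  show "a + b + c = a + (b + c)" "a + b = b + a" "0 + a = a" "- a + a = 0" "a - b = a + - b"
    by (transfer, simp add: algebra_simps)+
  show "r *\<^sub>R (a + b) = r *\<^sub>R a + r *\<^sub>R b" "(r + q) *\<^sub>R a = r *\<^sub>R a + q *\<^sub>R a"
    "r *\<^sub>R q *\<^sub>R a = (r * q) *\<^sub>R a" "1 *\<^sub>R a = a"
    by (transfer, simp add: algebra_simps)+
  show "dist a b = norm (a - b)" by (fact dist_ell1_def)
  show "sgn a = inverse (norm a) *\<^sub>R a" by (fact sgn_ell1_def)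
  show "uniformity = (INF e\<in>{0<..}. principal {(x, y :: 'a ell1). dist x y < e})"
    by (fact uniformity_ell1_def)
  show "open U = (\<forall>x\<in>U. \<forall>\<^sub>F (x', y) in uniformity. x' = x \<longrightarrow> y \<in> U)"
    by (fact open_ell1_def)
  show "norm a = 0 \<longleftrightarrow> a = 0"
  proof
    assume "norm a = 0"
    then have "norm (ell1_apply a s) = 0" for s
      using nonneg_infsum_le_0D[OF _ ell1_abs_summable[of a], of s] by (simp add: norm_ell1.rep_eq)
    then show "a = 0" by (simp add: ell1_eqI zero_ell1.rep_eq)
  qed (simp add: norm_ell1.rep_eq zero_ell1.rep_eq)
  have "norm (a + b) \<le> (\<Sum>\<^sub>\<infinity>s. norm (ell1_apply a s) + norm (ell1_apply b s))"
    unfolding norm_ell1.rep_eq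
    by (intro infsum_mono ell1_abs_summable summable_on_add)
      (simp add: plus_ell1.rep_eq norm_triangle_ineq)
  also have "\<dots> = norm a + norm b"
    unfolding norm_ell1.rep_eq by (rule infsum_add[OF ell1_abs_summable ell1_abs_summable])
  finally show "norm (a + b) \<le> norm a + norm b" .
  show "norm (r *\<^sub>R a) = \<bar>r\<bar> * norm a"
    unfolding norm_ell1.rep_eq scaleR_ell1.rep_eq norm_scaleR by (rule infsum_cmult_right')
qed

end

lemma sum_le_norm_ell1: "finite F \<Longrightarrow> (\<Sum>s\<in>F. norm (ell1_apply a s)) \<le> norm a"
  unfolding norm_ell1.rep_eq by (rule finite_sum_le_infsum[OF ell1_abs_summable]) auto

lemma norm_ell1_le:
  assumes "\<And>F. finite F \<Longrightarrow> (\<Sum>s\<in>F. norm (ell1_apply a s)) \<le> C"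
  shows "norm a \<le> C"
  unfolding norm_ell1.rep_eq by (rule infsum_le_finite_sums[OF ell1_abs_summable]) (use assms in auto)

lemma norm_ell1_apply_le: "norm (ell1_apply a s) \<le> norm a"
  using sum_le_norm_ell1[of "{s}" a] by simp

instance ell1 :: (type) banach
proof
  fix X :: "nat \<Rightarrow> 'a ell1" assume X: "Cauchy X"
  have "Cauchy (\<lambda>n. ell1_apply (X n) s)" for s
  proof (rule metric_CauchyI)
    fix e :: real assume "0 < e"
    then obtain M where M: "\<forall>m\<ge>M. \<forall>n\<ge>M. dist (X m) (X n) < e"
      using X by (auto simp: Cauchy_def)
    have "dist (ell1_apply (X m) s) (ell1_apply (X n) s) < e" if "m \<ge> M" "n \<ge> M" for m n
      using M that norm_ell1_apply_le[of "X m - X n" s]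
      by (fastforce simp: dist_norm minus_ell1.rep_eq)
    then show "\<exists>M. \<forall>m\<ge>M. \<forall>n\<ge>M. dist (ell1_apply (X m) s) (ell1_apply (X n) s) < e" by blast
  qed
  then have "\<forall>s. \<exists>l. (\<lambda>n. ell1_apply (X n) s) \<longlonglongrightarrow> l"
    using convergent_eq_Cauchy by blast
  then obtain l where l: "\<And>s. (\<lambda>n. ell1_apply (X n) s) \<longlonglongrightarrow> l s" by metis
  have fin: "(\<Sum>s\<in>F. norm (ell1_apply (X m) s - l s)) \<le> e"
    if M: "\<forall>m\<ge>M. \<forall>n\<ge>M. dist (X m) (X n) < e" and "m \<ge> M" and F: "finite F" for M m e F
  proof (rule tendsto_upperbound)
    show "(\<lambda>n. \<Sum>s\<in>F. norm (ell1_apply (X m) s - ell1_apply (X n) s))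
        \<longlonglongrightarrow> (\<Sum>s\<in>F. norm (ell1_apply (X m) s - l s))"
      by (intro tendsto_intros l)
    have "(\<Sum>s\<in>F. norm (ell1_apply (X m) s - ell1_apply (X n) s)) \<le> e" if "n \<ge> M" for n
      using sum_le_norm_ell1[OF F, of "X m - X n"] M \<open>n \<ge> M\<close> \<open>m \<ge> M\<close>
      by (fastforce simp: dist_norm minus_ell1.rep_eq)
    then show "\<forall>\<^sub>F n in sequentially. (\<Sum>s\<in>F. norm (ell1_apply (X m) s - ell1_apply (X n) s)) \<le> e"
      by (auto simp: eventually_sequentially)
  qed simp
  have diff: "(\<lambda>s. norm (ell1_apply (X m) s - l s)) summable_on UNIV"
    if M: "\<forall>m\<ge>M. \<forall>n\<ge>M. dist (X m) (X n) < e" and "m \<ge> M" for M m e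
    unfolding abs_summable_iff_bdd_above using fin[OF that] by (auto intro!: bdd_aboveI2)
  obtain M1 where M1: "\<forall>m\<ge>M1. \<forall>n\<ge>M1. dist (X m) (X n) < 1"
    using X unfolding Cauchy_def by (meson zero_less_one)
  have "(\<lambda>s. norm (l s)) summable_on UNIV"
  proof (rule Infinite_Sum.abs_summable_on_comparison_test')
    show "(\<lambda>s. norm (ell1_apply (X M1) s) + norm (ell1_apply (X M1) s - l s)) summable_on UNIV"
      using diff[OF M1] by (intro summable_on_add ell1_abs_summable) auto
    show "norm (l s) \<le> norm (ell1_apply (X M1) s) + norm (ell1_apply (X M1) s - l s)" for s
      using norm_triangle_ineq4[of "ell1_apply (X M1) s" "ell1_apply (X M1) s - l s"] by simp
  qed
  then have L: "ell1_apply (Abs_ell1 l) = l" by (simp add: Abs_ell1_inverse)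
  have "X \<longlonglongrightarrow> Abs_ell1 l"
  proof (rule metric_LIMSEQ_I)
    fix e :: real assume "0 < e"
    then obtain M where M: "\<forall>m\<ge>M. \<forall>n\<ge>M. dist (X m) (X n) < e / 2"
      using X half_gt_zero unfolding Cauchy_def by blast
    have "dist (X m) (Abs_ell1 l) < e" if "m \<ge> M" for m
    proof -
      have "norm (X m - Abs_ell1 l) \<le> e / 2"
        by (rule norm_ell1_le) (use fin[OF M that] in \<open>simp add: minus_ell1.rep_eq L\<close>)
      with \<open>0 < e\<close> show ?thesis by (simp add: dist_norm)
    qed
    then show "\<exists>M. \<forall>m\<ge>M. dist (X m) (Abs_ell1 l) < e" by blast
  qed
  then show "convergent X" by (auto simp: convergent_def)
qed

lemma abs_summable_tensor:
  fixes a b :: "_ \<Rightarrow> complex"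
  assumes a: "(\<lambda>s. norm (a s)) summable_on UNIV" and b: "(\<lambda>s. norm (b s)) summable_on UNIV"
  shows "(\<lambda>p. norm (a (fst p) * b (snd p))) summable_on UNIV"
    and "(\<Sum>\<^sub>\<infinity>p. norm (a (fst p) * b (snd p))) = (\<Sum>\<^sub>\<infinity>s. norm (a s)) * (\<Sum>\<^sub>\<infinity>t. norm (b t))"
proof -
  have 1: "(\<lambda>t. norm (a s * b t)) summable_on UNIV" for s
    unfolding norm_mult by (rule summable_on_cmult_right[OF b])
  have 2: "(\<lambda>s. norm (\<Sum>\<^sub>\<infinity>t. norm (a s * b t))) summable_on UNIV"
    unfolding norm_mult infsum_cmult_right' real_norm_def abs_mult abs_norm_cancel
    by (rule summable_on_cmult_left[OF a])
  have 3: "(\<lambda>p. norm (a (fst p) * b (snd p))) summable_on (UNIV \<times> UNIV)"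
    by (subst Infinite_Sum.abs_summable_on_Sigma_iff) (use 1 2 in simp)
  then show "(\<lambda>p. norm (a (fst p) * b (snd p))) summable_on UNIV" by simp
  show "(\<Sum>\<^sub>\<infinity>p. norm (a (fst p) * b (snd p))) = (\<Sum>\<^sub>\<infinity>s. norm (a s)) * (\<Sum>\<^sub>\<infinity>t. norm (b t))"
    using infsum_Sigma_banach[OF 3]
    by (simp add: norm_mult infsum_cmult_right' infsum_cmult_left')
qed

lemma conv_partition:
  fixes F :: "'a::semigroup_mult \<times> 'a \<Rightarrow> 'c::banach"
  assumes "F summable_on UNIV"
  shows "(\<Sum>\<^sub>\<infinity>u. \<Sum>\<^sub>\<infinity>p\<in>{(s,t). s * t = u}. F p) = (\<Sum>\<^sub>\<infinity>p. F p)"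
    and "(\<lambda>u. \<Sum>\<^sub>\<infinity>p\<in>{(s,t). s * t = u}. F p) summable_on UNIV"
proof -
  let ?S = "SIGMA u:(UNIV::'a set). {(s,t). s * t = u}"
  have bij: "bij_betw snd ?S UNIV"
    by (rule bij_betwI[where g = "\<lambda>(s,t). (s * t, s, t)"]) auto
  have sm: "(\<lambda>(u,p). F p) summable_on ?S"
    using summable_on_reindex_bij_betw[OF bij, of F] assms by (simp add: case_prod_unfold)
  show "(\<Sum>\<^sub>\<infinity>u. \<Sum>\<^sub>\<infinity>p\<in>{(s,t). s * t = u}. F p) = (\<Sum>\<^sub>\<infinity>p. F p)"
    using infsum_Sigma'_banach[OF sm] infsum_reindex_bij_betw[OF bij, of F]
    by (simp add: case_prod_unfold)
  show "(\<lambda>u. \<Sum>\<^sub>\<infinity>p\<in>{(s,t). s * t = u}. F p) summable_on UNIV"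
    using summable_on_Sigma_banach[OF sm] by simp
qed

lemma conv_abs_summable:
  fixes a b :: "'a::semigroup_mult \<Rightarrow> complex"
  assumes a: "(\<lambda>s. norm (a s)) summable_on UNIV" and b: "(\<lambda>s. norm (b s)) summable_on UNIV"
  shows "(\<lambda>u. norm (\<Sum>\<^sub>\<infinity>p\<in>{(s,t). s * t = u}. a (fst p) * b (snd p))) summable_on UNIV"
    and "(\<Sum>\<^sub>\<infinity>u. norm (\<Sum>\<^sub>\<infinity>p\<in>{(s,t). s * t = u}. a (fst p) * b (snd p)))
      \<le> (\<Sum>\<^sub>\<infinity>s. norm (a s)) * (\<Sum>\<^sub>\<infinity>t. norm (b t))"
proof -
  let ?F = "\<lambda>p. norm (a (fst p) * b (snd p))"
  have F: "?F summable_on UNIV" using abs_summable_tensor(1)[OF a b] .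
  have le: "norm (\<Sum>\<^sub>\<infinity>p\<in>{(s,t). s * t = u}. a (fst p) * b (snd p))
      \<le> (\<Sum>\<^sub>\<infinity>p\<in>{(s,t). s * t = u}. ?F p)" for u
    by (rule norm_infsum_bound) (rule summable_on_subset_banach[OF F], simp)
  show sm: "(\<lambda>u. norm (\<Sum>\<^sub>\<infinity>p\<in>{(s,t). s * t = u}. a (fst p) * b (snd p))) summable_on UNIV"
    by (rule Infinite_Sum.abs_summable_on_comparison_test'[OF conv_partition(2)[OF F] le])
  have "(\<Sum>\<^sub>\<infinity>u. norm (\<Sum>\<^sub>\<infinity>p\<in>{(s,t). s * t = u}. a (fst p) * b (snd p))) \<le> (\<Sum>\<^sub>\<infinity>p. ?F p)"
    unfolding conv_partition(1)[OF F, symmetric]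
    by (rule infsum_mono[OF sm conv_partition(2)[OF F] le])
  also have "(\<Sum>\<^sub>\<infinity>p. ?F p) = (\<Sum>\<^sub>\<infinity>s. norm (a s)) * (\<Sum>\<^sub>\<infinity>t. norm (b t))"
    by (rule abs_summable_tensor(2)[OF a b])
  finally show "(\<Sum>\<^sub>\<infinity>u. norm (\<Sum>\<^sub>\<infinity>p\<in>{(s,t). s * t = u}. a (fst p) * b (snd p)))
      \<le> (\<Sum>\<^sub>\<infinity>s. norm (a s)) * (\<Sum>\<^sub>\<infinity>t. norm (b t))" .
qed

lemma infsum_one:
  fixes f :: "'a \<Rightarrow> complex"
  assumes "\<And>s. s \<in> A \<Longrightarrow> s \<noteq> u \<Longrightarrow> f s = 0"
  shows "infsum f A = (if u \<in> A then f u else 0)"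
proof (rule infsumI, rule has_sum_finite_neutralI)
  show "finite (if u \<in> A then {u} else {})" "(if u \<in> A then {u} else {}) \<subseteq> A"
    by auto
qed (use assms in \<open>auto split: if_splits\<close>)

lemma pairing_abs_summable:
  assumes "bounded (range f)"
  shows "(\<lambda>s. norm (f s * ell1_apply a s :: complex)) summable_on UNIV"
proof -
  obtain K where K: "\<And>s. norm (f s) \<le> K"
    using assms by (auto simp: bounded_iff)
  show ?thesis
  proof (rule Infinite_Sum.abs_summable_on_comparison_test')
    show "(\<lambda>s. K * norm (ell1_apply a s)) summable_on UNIV"
      by (rule summable_on_cmult_right[OF ell1_abs_summable])
    show "norm (f s * ell1_apply a s) \<le> K * norm (ell1_apply a s)" for s
      by (simp add: norm_mult K mult_right_mono)
  qed
qed

lemma pairing_norm_le: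
  assumes K: "\<And>s. norm (f s) \<le> K"
  shows "norm (\<Sum>\<^sub>\<infinity>s. f s * ell1_apply a s) \<le> K * norm a"
proof -
  have b: "bounded (range f)" using K by (auto simp: bounded_iff)
  have "norm (\<Sum>\<^sub>\<infinity>s. f s * ell1_apply a s) \<le> (\<Sum>\<^sub>\<infinity>s. norm (f s * ell1_apply a s))"
    by (rule norm_infsum_bound[OF pairing_abs_summable[OF b]])
  also have "\<dots> \<le> (\<Sum>\<^sub>\<infinity>s. K * norm (ell1_apply a s))"
    by (rule infsum_mono[OF pairing_abs_summable[OF b] summable_on_cmult_right[OF ell1_abs_summable]])
      (simp add: norm_mult K mult_right_mono)
  also have "\<dots> = K * norm a"
    by (simp add: infsum_cmult_right' norm_ell1.rep_eq)
  finally show ?thesis .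
qed

instantiation ell1 :: (semigroup_mult) complex_banach_algebra
begin

lift_definition scaleC_ell1 :: "complex \<Rightarrow> 'a ell1 \<Rightarrow> 'a ell1" is "\<lambda>c a s. c * a s"
  by (simp add: norm_mult summable_on_cmult_right)

lift_definition times_ell1 :: "'a ell1 \<Rightarrow> 'a ell1 \<Rightarrow> 'a ell1"
  is "\<lambda>a b u. \<Sum>\<^sub>\<infinity>p\<in>{(s,t). s * t = u}. a (fst p) * b (snd p)"
  by (rule conv_abs_summable(1))

lemma tensor_summable:
  "(\<lambda>p. ell1_apply a (fst p) * ell1_apply b (snd p)) summable_on A"
  by (rule summable_on_subset_banach[OF abs_summable_summable
      [OF abs_summable_tensor(1)[OF ell1_abs_summable ell1_abs_summable]]]) simp

lemma pairing_mult:
  assumes f: "bounded (range f)"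
  shows "(\<Sum>\<^sub>\<infinity>u. f u * ell1_apply (a * b) u)
    = (\<Sum>\<^sub>\<infinity>s. ell1_apply a s * (\<Sum>\<^sub>\<infinity>t. f (s * t) * ell1_apply b t))"
proof -
  let ?F = "\<lambda>p. f (fst p * snd p) * (ell1_apply a (fst p) * ell1_apply b (snd p))"
  obtain K where K: "\<And>s. norm (f s) \<le> K"
    using f by (auto simp: bounded_iff)
  have "(\<lambda>p. norm (?F p)) summable_on UNIV"
  proof (rule Infinite_Sum.abs_summable_on_comparison_test')
    show "(\<lambda>p. K * norm (ell1_apply a (fst p) * ell1_apply b (snd p))) summable_on UNIV"
      by (intro summable_on_cmult_right abs_summable_tensor ell1_abs_summable)
    show "norm (?F p) \<le> K * norm (ell1_apply a (fst p) * ell1_apply b (snd p))" for p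
      unfolding norm_mult[of "f _"] by (rule mult_right_mono[OF K norm_ge_zero])
  qed
  then have F: "?F summable_on UNIV" by (rule abs_summable_summable)
  have "(\<Sum>\<^sub>\<infinity>u. f u * ell1_apply (a * b) u) = (\<Sum>\<^sub>\<infinity>u. \<Sum>\<^sub>\<infinity>p\<in>{(s,t). s * t = u}. ?F p)"
    unfolding times_ell1.rep_eq infsum_cmult_right'[symmetric]
    by (intro infsum_cong) auto
  also have "\<dots> = (\<Sum>\<^sub>\<infinity>p\<in>UNIV \<times> UNIV. ?F p)"
    using conv_partition(1)[OF F] by simp
  also have "\<dots> = (\<Sum>\<^sub>\<infinity>s. \<Sum>\<^sub>\<infinity>t. ?F (s, t))"
    by (rule infsum_Sigma_banach[symmetric]) (use F in simp)
  also have "\<dots> = (\<Sum>\<^sub>\<infinity>s. ell1_apply a s * (\<Sum>\<^sub>\<infinity>t. f (s * t) * ell1_apply b t))"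
    unfolding infsum_cmult_right'[symmetric] by (simp add: mult.left_commute)
  finally show ?thesis .
qed

lemma pairing_indicator: "(\<Sum>\<^sub>\<infinity>s. (if s = u then 1 else 0) * ell1_apply a s) = ell1_apply a u"
  by (subst infsum_one[where u = u]) auto

instance
proof
  fix a b c :: "'a ell1" and r :: real and z w :: complex
  show "a * b * c = a * (b * c)"
  proof (rule ell1_eqI)
    fix u :: 'a
    define f where "f s = (if s = u then 1 else 0 :: complex)" for s
    define g where "g v = (\<Sum>\<^sub>\<infinity>t. f (v * t) * ell1_apply c t)" for v
    have f: "bounded (range (\<lambda>s. f (h s)))" for h :: "'a \<Rightarrow> 'a"
      by (auto simp: f_def bounded_iff intro!: exI[of _ 1])
    have fid: "bounded (range f)" using f[of "\<lambda>s. s"] by simp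
    have f_apply: "(\<Sum>\<^sub>\<infinity>s. f s * ell1_apply d s) = ell1_apply d u" for d
      unfolding f_def by (rule pairing_indicator)
    have "norm (g v) \<le> 1 * norm c" for v
      unfolding g_def by (rule pairing_norm_le) (simp add: f_def)
    then have g: "bounded (range g)" by (auto simp: bounded_iff)
    have "ell1_apply (a * b * c) u = (\<Sum>\<^sub>\<infinity>v. g v * ell1_apply (a * b) v)"
      unfolding g_def f_apply[of "a * b * c", symmetric] pairing_mult[OF fid]
      by (simp add: mult.commute)
    also have "\<dots> = (\<Sum>\<^sub>\<infinity>r. ell1_apply a r * (\<Sum>\<^sub>\<infinity>s. g (r * s) * ell1_apply b s))"
      by (rule pairing_mult[OF g])
    also have "\<dots> = (\<Sum>\<^sub>\<infinity>r. ell1_apply a r * (\<Sum>\<^sub>\<infinity>v. f (r * v) * ell1_apply (b * c) v))"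
      unfolding pairing_mult[OF f] by (simp add: g_def mult.assoc mult.commute[of _ "ell1_apply b _"])
    also have "\<dots> = ell1_apply (a * (b * c)) u"
      unfolding pairing_mult[OF fid, symmetric] f_apply ..
    finally show "ell1_apply (a * b * c) u = ell1_apply (a * (b * c)) u" .
  qed
  show "(a + b) * c = a * c + b * c"
    by (rule ell1_eqI) (simp add: times_ell1.rep_eq plus_ell1.rep_eq distrib_right
        infsum_add tensor_summable)
  show "a * (b + c) = a * b + a * c"
    by (rule ell1_eqI) (simp add: times_ell1.rep_eq plus_ell1.rep_eq distrib_left
        infsum_add tensor_summable)
  show "(r *\<^sub>R a) * b = r *\<^sub>R (a * b)" "a * (r *\<^sub>R b) = r *\<^sub>R (a * b)"
    "(z *\<^sub>C a) * b = z *\<^sub>C (a * b)" "a * (z *\<^sub>C b) = z *\<^sub>C (a * b)"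
    by (rule ell1_eqI, simp add: times_ell1.rep_eq scaleR_ell1.rep_eq scaleC_ell1.rep_eq
        scaleR_conv_of_real mult.assoc mult.left_commute[of "ell1_apply a _"] infsum_cmult_right')+
  show "norm (a * b) \<le> norm a * norm b"
    unfolding norm_ell1.rep_eq times_ell1.rep_eq
    by (rule conv_abs_summable(2)[OF ell1_abs_summable ell1_abs_summable])
  show "z *\<^sub>C (a + b) = z *\<^sub>C a + z *\<^sub>C b" "(z + w) *\<^sub>C a = z *\<^sub>C a + w *\<^sub>C a"
    "z *\<^sub>C w *\<^sub>C a = (z * w) *\<^sub>C a" "of_real r *\<^sub>C a = r *\<^sub>R a"
    by (rule ell1_eqI, simp add: plus_ell1.rep_eq scaleR_ell1.rep_eq scaleC_ell1.rep_eq
        algebra_simps scaleR_conv_of_real)+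
  show "norm (z *\<^sub>C a) = norm z * norm a"
    unfolding norm_ell1.rep_eq scaleC_ell1.rep_eq norm_mult by (rule infsum_cmult_right')
qed

end

lift_definition delta :: "'a \<Rightarrow> 'a ell1" is "\<lambda>s t. if t = s then 1 else 0"
  by (rule finite_nonzero_values_imp_summable_on) simp

lemma norm_delta [simp]: "norm (delta s) = 1"
proof -
  have "((\<lambda>t. norm (ell1_apply (delta s) t)) has_sum 1) UNIV"
    by (rule has_sum_finite_neutralI[where B = "{s}"]) (auto simp: delta.rep_eq)
  then show ?thesis by (simp add: norm_ell1.rep_eq infsumI)
qed

lemma delta_mult: "delta s * delta t = delta (s * t)"
proof (rule ell1_eqI)
  fix u
  have "ell1_apply (delta s * delta t) u
      = (\<Sum>\<^sub>\<infinity>p\<in>{(s,t). s * t = u}. if p = (s, t) then 1 else 0)"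
    unfolding times_ell1.rep_eq delta.rep_eq by (intro infsum_cong) auto
  also have "\<dots> = (if s * t = u then 1 else 0)"
    by (subst infsum_one[where u = "(s, t)"]) auto
  finally show "ell1_apply (delta s * delta t) u = ell1_apply (delta (s * t)) u"
    by (auto simp: delta.rep_eq)
qed

lemma delta_has_sum: "((\<lambda>s. ell1_apply a s *\<^sub>C delta s) has_sum a) UNIV"
  unfolding has_sum_def tendsto_iff eventually_finite_subsets_at_top
proof safe
  fix e :: real assume "0 < e"
  have "((\<lambda>s. norm (ell1_apply a s)) has_sum norm a) UNIV"
    unfolding norm_ell1.rep_eq by (rule has_sum_infsum[OF ell1_abs_summable])
  then obtain X where X: "finite X"
    "\<And>Y. finite Y \<Longrightarrow> X \<subseteq> Y \<Longrightarrow> dist (\<Sum>s\<in>Y. norm (ell1_apply a s)) (norm a) < e"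
    using \<open>0 < e\<close> unfolding has_sum_def tendsto_iff eventually_finite_subsets_at_top
    by (metis subset_UNIV)
  have "dist (\<Sum>s\<in>Y. ell1_apply a s *\<^sub>C delta s) a < e" if Y: "finite Y" "X \<subseteq> Y" for Y
  proof -
    have sum_apply: "ell1_apply (\<Sum>s\<in>Y. ell1_apply a s *\<^sub>C delta s) t
        = (if t \<in> Y then ell1_apply a t else 0)" for t
    proof -
      have "ell1_apply (\<Sum>s\<in>Y. ell1_apply a s *\<^sub>C delta s) t
          = (\<Sum>s\<in>Y. if t = s then ell1_apply a s else 0)"
        using Y(1) by (induction Y rule: finite_induct)
          (auto simp: zero_ell1.rep_eq plus_ell1.rep_eq scaleC_ell1.rep_eq delta.rep_eq)
      then show ?thesis using Y(1) by simp
    qed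
    have "norm (a - (\<Sum>s\<in>Y. ell1_apply a s *\<^sub>C delta s)) \<le> norm a - (\<Sum>s\<in>Y. norm (ell1_apply a s))"
    proof (rule norm_ell1_le)
      fix F :: "'a set" assume F: "finite F"
      have "(\<Sum>t\<in>F. norm (ell1_apply (a - (\<Sum>s\<in>Y. ell1_apply a s *\<^sub>C delta s)) t))
          = (\<Sum>t\<in>F - Y. norm (ell1_apply a t))"
        by (rule sum.mono_neutral_cong_right) (use F in \<open>auto simp: minus_ell1.rep_eq sum_apply\<close>)
      also have "\<dots> = (\<Sum>t\<in>(F - Y) \<union> Y. norm (ell1_apply a t)) - (\<Sum>s\<in>Y. norm (ell1_apply a s))"
        by (subst sum.union_disjoint) (use F Y in auto)
      also have "\<dots> \<le> norm a - (\<Sum>s\<in>Y. norm (ell1_apply a s))"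
        using sum_le_norm_ell1[of "(F - Y) \<union> Y" a] F Y by simp
      finally show "(\<Sum>t\<in>F. norm (ell1_apply (a - (\<Sum>s\<in>Y. ell1_apply a s *\<^sub>C delta s)) t))
          \<le> norm a - (\<Sum>s\<in>Y. norm (ell1_apply a s))" .
    qed
    then show ?thesis
      using X(2)[OF Y] by (simp add: dist_norm norm_minus_commute dist_real_def)
  qed
  then show "\<exists>X. finite X \<and> X \<subseteq> UNIV \<and> (\<forall>Y. finite Y \<and> X \<subseteq> Y \<and> Y \<subseteq> UNIV \<longrightarrow>
      dist (\<Sum>s\<in>Y. ell1_apply a s *\<^sub>C delta s) a < e)"
    using X(1) by blast
qed


section \<open>The dual as the space of bounded functions\<close>

definition linfty_functional :: "('a \<Rightarrow> complex) \<Rightarrow> ('a ell1 \<Rightarrow>\<^sub>L complex)" where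
  "linfty_functional f = Blinfun (\<lambda>a. \<Sum>\<^sub>\<infinity>s. f s * ell1_apply a s)"

lemma linfty_functional_apply:
  assumes f: "bounded (range f)"
  shows "blinfun_apply (linfty_functional f) a = (\<Sum>\<^sub>\<infinity>s. f s * ell1_apply a s)"
proof -
  obtain K where K: "\<And>s. norm (f s) \<le> K"
    using f by (auto simp: bounded_iff)
  have sm: "(\<lambda>s. f s * ell1_apply a s) summable_on UNIV" for a
    by (rule abs_summable_summable[OF pairing_abs_summable[OF f]])
  have "bounded_linear (\<lambda>a. \<Sum>\<^sub>\<infinity>s. f s * ell1_apply a s)"
  proof (rule bounded_linear_intro[where K = K])
    fix a b :: "'a ell1" and r :: real
    show "(\<Sum>\<^sub>\<infinity>s. f s * ell1_apply (a + b) s)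
        = (\<Sum>\<^sub>\<infinity>s. f s * ell1_apply a s) + (\<Sum>\<^sub>\<infinity>s. f s * ell1_apply b s)"
      by (simp add: plus_ell1.rep_eq distrib_left infsum_add sm)
    show "(\<Sum>\<^sub>\<infinity>s. f s * ell1_apply (r *\<^sub>R a) s) = r *\<^sub>R (\<Sum>\<^sub>\<infinity>s. f s * ell1_apply a s)"
      by (simp add: scaleR_ell1.rep_eq scaleR_conv_of_real mult.left_commute[of "f _"]
          infsum_cmult_right')
    show "norm (\<Sum>\<^sub>\<infinity>s. f s * ell1_apply a s) \<le> norm a * K"
      by (rule order_trans[OF pairing_norm_le[OF K]]) (simp add: mult.commute)
  qed
  then show ?thesis by (simp add: linfty_functional_def bounded_linear_Blinfun_apply)
qed

lemma linfty_functional_delta: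
  "bounded (range f) \<Longrightarrow> blinfun_apply (linfty_functional f) (delta s) = f s"
  by (simp add: linfty_functional_apply delta.rep_eq, subst infsum_one[where u = s]) auto

lemma linfty_functional_in_cdual:
  fixes f :: "'a::semigroup_mult \<Rightarrow> complex"
  shows "bounded (range f) \<Longrightarrow> linfty_functional f \<in> cdual"
  by (simp add: cdual_def linfty_functional_apply scaleC_ell1.rep_eq mult.left_commute[of "f _"]
      infsum_cmult_right')

lemma cdual_eqI:
  fixes \<phi> \<psi> :: "'a::semigroup_mult ell1 \<Rightarrow>\<^sub>L complex"
  assumes "\<phi> \<in> cdual" "\<psi> \<in> cdual" and eq: "\<And>s. \<phi> (delta s) = \<psi> (delta s)"
  shows "\<phi> = \<psi>"
proof (rule blinfun_eqI)
  fix a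
  have *: "((\<lambda>s. ell1_apply a s * \<theta> (delta s)) has_sum \<theta> a) UNIV" if "\<theta> \<in> cdual"
    for \<theta> :: "'a ell1 \<Rightarrow>\<^sub>L complex"
    using has_sum_bounded_linear[OF blinfun.bounded_linear_right[of \<theta>] delta_has_sum[of a]] that
    by (simp add: cdual_def o_def)
  show "blinfun_apply \<phi> a = blinfun_apply \<psi> a"
    using *[OF assms(1)] *[OF assms(2)] unfolding eq by (rule has_sum_unique)
qed

lemma norm_linfty_functional:
  assumes f: "bounded (range f)"
  shows "norm (linfty_functional f) = (SUP s. norm (f s))"
proof (rule antisym)
  have bdd: "bdd_above (range (\<lambda>s. norm (f s)))"
    using f by (auto simp: bounded_iff bdd_above_def)
  have up: "norm (f s) \<le> (SUP s. norm (f s))" for s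
    by (rule cSUP_upper[OF UNIV_I bdd])
  show "norm (linfty_functional f) \<le> (SUP s. norm (f s))"
    by (rule norm_blinfun_bound[OF order_trans[OF norm_ge_zero up]])
      (simp add: linfty_functional_apply[OF f] pairing_norm_le up)
  show "(SUP s. norm (f s)) \<le> norm (linfty_functional f)"
  proof (rule cSUP_least)
    show "norm (f s) \<le> norm (linfty_functional f)" for s
      using norm_blinfun[of "linfty_functional f" "delta s"]
      by (simp add: linfty_functional_delta[OF f])
  qed simp
qed

lemma bij_betw_linfty_functional:
  "bij_betw linfty_functional {f :: 'a::semigroup_mult \<Rightarrow> complex. bounded (range f)} cdual"
proof (rule bij_betwI[where g = "\<lambda>\<phi> s. blinfun_apply \<phi> (delta s)"])
  have b: "bounded (range (\<lambda>s. blinfun_apply \<phi> (delta s)))" for \<phi> :: "'a ell1 \<Rightarrow>\<^sub>L complex"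
    using norm_blinfun[of \<phi> "delta _"] by (auto simp: bounded_iff)
  then show "(\<lambda>\<phi> s. blinfun_apply \<phi> (delta s)) \<in>
      cdual \<rightarrow> {f :: 'a \<Rightarrow> complex. bounded (range f)}" by simp
  show "linfty_functional (\<lambda>s. blinfun_apply \<phi> (delta s)) = \<phi>"
    if "\<phi> \<in> cdual" for \<phi> :: "'a ell1 \<Rightarrow>\<^sub>L complex"
    by (rule cdual_eqI) (simp_all add: linfty_functional_in_cdual linfty_functional_delta b that)
qed (auto simp: linfty_functional_in_cdual linfty_functional_delta)

lemma lact_delta:
  fixes f :: "'a::semigroup_mult \<Rightarrow> complex"
  assumes f: "bounded (range f)"
  shows "lact (delta s) (linfty_functional f) = linfty_functional (\<lambda>t. f (t * s))"
proof -
  have b: "bounded (range (\<lambda>t. f (t * s)))"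
    using f by (rule bounded_subset) auto
  show ?thesis
    using linfty_functional_in_cdual[OF f]
    by (intro cdual_eqI linfty_functional_in_cdual b)
      (simp_all add: cdual_def mult_scaleC_left delta_mult linfty_functional_delta f b)
qed

lemma ract_delta:
  fixes f :: "'a::semigroup_mult \<Rightarrow> complex"
  assumes f: "bounded (range f)"
  shows "ract (linfty_functional f) (delta s) = linfty_functional (\<lambda>t. f (s * t))"
proof -
  have b: "bounded (range (\<lambda>t. f (s * t)))"
    using f by (rule bounded_subset) auto
  show ?thesis
    using linfty_functional_in_cdual[OF f]
    by (intro cdual_eqI linfty_functional_in_cdual b)
      (simp_all add: cdual_def mult_scaleC_right delta_mult linfty_functional_delta f b)
qed


section \<open>Semitopological semigroups and continuous functions vanishing at infinity\<close>

definition semitopological_semigroup :: "'a::semigroup_mult topology \<Rightarrow> bool" where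
  "semitopological_semigroup \<sigma> \<longleftrightarrow> topspace \<sigma> = UNIV \<and>
     (\<forall>s. continuous_map \<sigma> \<sigma> (\<lambda>t. s * t) \<and> continuous_map \<sigma> \<sigma> (\<lambda>t. t * s))"

definition C0_functions :: "'a topology \<Rightarrow> ('a \<Rightarrow> complex) set" where
  "C0_functions \<sigma> = {f. continuous_map \<sigma> euclidean f \<and>
     (\<forall>e>0. compactin \<sigma> {s \<in> topspace \<sigma>. e \<le> norm (f s)})}"

lemma bounded_C0_functions:
  assumes "f \<in> C0_functions \<sigma>" and "topspace \<sigma> = UNIV"
  shows "bounded (range f)"
proof -
  have "compactin euclidean (f ` {s. 1 \<le> norm (f s)})"
    using assms by (intro image_compactin[of \<sigma>]) (auto simp: C0_functions_def)
  then have "bounded (f ` {s. 1 \<le> norm (f s)})"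
    by (simp add: compact_imp_bounded)
  moreover have "range f \<subseteq> f ` {s. 1 \<le> norm (f s)} \<union> cball 0 1"
    by auto
  ultimately show ?thesis
    by (meson bounded_Un bounded_cball bounded_subset)
qed

end

theory Submission
  imports Defs
begin

text \<open>A countable locally compact Hausdorff space has a base of compact open sets, since a
  continuous real function on it misses some level in every interval. Given a bounded functional
  \<open>\<psi>\<close> on \<open>C\<^sub>0\<close>, let \<open>V(A)\<close> be the supremum of \<open>\<bar>\<psi> f\<bar>\<close> over the \<open>f\<close> with \<open>\<bar>f\<bar> \<le> 1\<^sub>A\<close>; it is
  superadditive on disjoint sets and plays the part of the total variation. As \<open>K\<close> shrinks to \<open>s\<close>
  through compact open sets, \<open>\<psi>(1\<^sub>K)\<close> converges to a number \<open>a(s)\<close>, and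
  \<open>\<Sum>\<bar>a(s)\<bar> \<le> \<parallel>\<psi>\<parallel>\<close>. The defect \<open>\<psi>(1\<^sub>K) - \<Sum>\<^sub>s\<^sub>\<in>\<^sub>K a(s)\<close> is additive in \<open>K\<close> and arbitrarily small
  near each point; covering a compact open set by neighbourhoods of its countably many
  points with defects bounded by a convergent series shows that it vanishes. Hence every functional on
  \<open>C\<^sub>0\<close> is given by an element of \<open>\<ell>\<^sup>1\<close> of no larger norm, and the canonical map is a surjective isometry.\<close>

section \<open>Compact open sets and functions vanishing at infinity\<close>

definition compact_open :: "'a topology \<Rightarrow> 'a set \<Rightarrow> bool" where
  "compact_open \<sigma> K \<longleftrightarrow> compactin \<sigma> K \<and> openin \<sigma> K"

lemma compact_open_Un: "compact_open \<sigma> K \<Longrightarrow> compact_open \<sigma> L \<Longrightarrow> compact_open \<sigma> (K \<union> L)"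
  by (auto simp: compact_open_def compactin_Un)

lemma compact_open_Int:
  "Hausdorff_space \<sigma> \<Longrightarrow> compact_open \<sigma> K \<Longrightarrow> compact_open \<sigma> L \<Longrightarrow> compact_open \<sigma> (K \<inter> L)"
  by (auto simp: compact_open_def compactin_Int)

lemma compact_open_Diff:
  assumes "Hausdorff_space \<sigma>" "compact_open \<sigma> K" "compact_open \<sigma> L"
  shows "compact_open \<sigma> (K - L)"
proof -
  have "closedin \<sigma> K" "closedin \<sigma> L"
    using assms by (auto simp: compact_open_def intro: compactin_imp_closedin)
  then show ?thesis
    using assms closed_compactin[of \<sigma> K "K - L"] by (auto simp: compact_open_def)
qed

lemma countable_locally_compact_Hausdorff_compact_open_base:
  assumes count: "countable (topspace \<sigma>)"
    and lc: "locally_compact_space \<sigma>" and haus: "Hausdorff_space \<sigma>"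
    and U: "openin \<sigma> U" "s \<in> U"
  obtains K where "compact_open \<sigma> K" "s \<in> K" "K \<subseteq> U"
proof -
  have s: "s \<in> topspace \<sigma>" using U openin_subset by blast
  obtain V C where V: "openin \<sigma> V" "s \<in> V" "V \<subseteq> C" and C: "compactin \<sigma> C"
    using lc s unfolding locally_compact_space_def by metis
  \<comment> \<open>The function is made 1 off \<open>U \<inter> V\<close> rather than off
    \<open>U\<close>, so that every sublevel set below 1 lies in \<open>U\<close> and also in the
    compact set \<open>C\<close>.\<close>
  have "closedin \<sigma> (topspace \<sigma> - (U \<inter> V))" "s \<in> topspace \<sigma> - (topspace \<sigma> - (U \<inter> V))"
    using U V s by auto
  then obtain f :: "'a \<Rightarrow> real" where f: "continuous_map \<sigma> (top_of_set {0..1}) f"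
    "f s = 0" "f ` (topspace \<sigma> - (U \<inter> V)) \<subseteq> {1}"
    using locally_compact_regular_imp_completely_regular_space[OF lc] haus
    unfolding completely_regular_space_def by metis
  have cont: "continuous_map \<sigma> euclideanreal f"
    using f(1) continuous_map_in_subtopology by blast
  \<comment> \<open>A level missed by the countable range makes the sublevel set clopen.\<close>
  obtain r where r: "0 < r" "r < 1" "r \<notin> f ` topspace \<sigma>"
    using real_interval_avoid_countable_set[of 0 1 "f ` topspace \<sigma>"] count by auto
  let ?K = "{t \<in> topspace \<sigma>. f t \<in> {..<r}}"
  have op: "openin \<sigma> ?K"
    by (rule openin_continuous_map_preimage[OF cont]) simp
  have "?K = {t \<in> topspace \<sigma>. f t \<in> {..r}}"
    using r(3) by (auto simp: less_le)
  then have cl: "closedin \<sigma> ?K"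
    using closedin_continuous_map_preimage[OF cont, of "{..r}"] by simp
  have sub: "?K \<subseteq> U \<inter> V"
    using f(3) r(2) by fastforce
  have "compactin \<sigma> ?K"
    by (rule closed_compactin[OF C _ cl]) (use sub V in blast)
  then show ?thesis
    using that[of ?K] op sub r(1) f(2) s by (auto simp: compact_open_def)
qed

section \<open>Linear and uniform closure of \<open>C0_functions\<close>\<close>

lemma C0_functionsI:
  assumes "continuous_map \<sigma> euclidean f"
    and "\<And>e. e > 0 \<Longrightarrow> \<exists>K. compactin \<sigma> K \<and> (\<forall>s\<in>topspace \<sigma>. e \<le> norm (f s) \<longrightarrow> s \<in> K)"
  shows "f \<in> C0_functions \<sigma>"
  unfolding C0_functions_def
proof safe
  fix e :: real assume "e > 0"
  then obtain K where K: "compactin \<sigma> K" "\<forall>s\<in>topspace \<sigma>. e \<le> norm (f s) \<longrightarrow> s \<in> K"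
    using assms(2) by blast
  \<comment> \<open>Continuity makes the set where \<open>norm (f s)\<close> is at least
    \<open>e\<close> closed, so it is compact as soon as some compact set contains it.\<close>
  have "continuous_map \<sigma> euclideanreal (\<lambda>s. norm (f s))"
    by (intro continuous_map_norm assms(1))
  then have "closedin \<sigma> {s \<in> topspace \<sigma>. norm (f s) \<in> {e..}}"
    by (rule closedin_continuous_map_preimage) simp
  then show "compactin \<sigma> {s \<in> topspace \<sigma>. e \<le> norm (f s)}"
    using K by (intro closed_compactin[OF K(1)]) auto
qed (fact assms(1))

lemma C0_functions_add:
  assumes f: "f \<in> C0_functions \<sigma>" and g: "g \<in> C0_functions \<sigma>"
  shows "(\<lambda>s. f s + g s) \<in> C0_functions \<sigma>"
proof (rule C0_functionsI)
  show "continuous_map \<sigma> euclidean (\<lambda>s. f s + g s)"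
    using f g by (auto simp: C0_functions_def intro: continuous_map_add)
  fix e :: real assume "e > 0"
  then have e: "e / 2 > 0" by simp
  let ?K = "\<lambda>h :: 'a \<Rightarrow> complex. {s \<in> topspace \<sigma>. e / 2 \<le> norm (h s)}"
  have "compactin \<sigma> (?K h)" if "h \<in> C0_functions \<sigma>" for h
    using that e unfolding C0_functions_def by blast
  then have "compactin \<sigma> (?K f \<union> ?K g)"
    using f g by (intro compactin_Un)
  moreover have "s \<in> ?K f \<union> ?K g" if "s \<in> topspace \<sigma>" "e \<le> norm (f s + g s)" for s
    using that norm_triangle_ineq[of "f s" "g s"] by auto
  ultimately show "\<exists>K. compactin \<sigma> K \<and> (\<forall>s\<in>topspace \<sigma>. e \<le> norm (f s + g s) \<longrightarrow> s \<in> K)"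
    by blast
qed

lemma C0_functions_scale:
  assumes f: "f \<in> C0_functions \<sigma>"
  shows "(\<lambda>s. c * f s) \<in> C0_functions \<sigma>"
proof (rule C0_functionsI)
  have "continuous_map euclidean euclidean ((*) c)"
    by (simp add: continuous_on_mult_left)
  then show "continuous_map \<sigma> euclidean (\<lambda>s. c * f s)"
    using f continuous_map_compose[of \<sigma> euclidean f euclidean "(*) c"]
    by (simp add: C0_functions_def o_def)
  fix e :: real assume "e > 0"
  \<comment> \<open>The added 1 covers \<open>c = 0\<close>.\<close>
  define d where "d = e / (norm c + 1)"
  have "d > 0" using \<open>e > 0\<close> by (simp add: d_def add_nonneg_pos)
  then have "compactin \<sigma> {s \<in> topspace \<sigma>. d \<le> norm (f s)}"
    using f by (auto simp: C0_functions_def)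
  moreover have "d \<le> norm (f s)" if "e \<le> norm (c * f s)" for s
  proof -
    have "e \<le> norm (f s) * (norm c + 1)"
      using that by (simp add: norm_mult algebra_simps add_increasing)
    then show ?thesis by (simp add: d_def pos_divide_le_eq add_nonneg_pos)
  qed
  ultimately show "\<exists>K. compactin \<sigma> K \<and> (\<forall>s\<in>topspace \<sigma>. e \<le> norm (c * f s) \<longrightarrow> s \<in> K)"
    by blast
qed

lemma C0_functions_zero: "(\<lambda>_. 0) \<in> C0_functions \<sigma>"
  by (rule C0_functionsI) (auto intro: exI[of _ "{}"])

lemma continuous_map_indicator:
  assumes "openin \<sigma> K" "closedin \<sigma> K"
  shows "continuous_map \<sigma> euclidean (indicator K :: 'a \<Rightarrow> complex)"
proof -
  have "openin \<sigma> {s \<in> topspace \<sigma>. indicator K s \<in> U}" for U :: "complex set"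
  proof -
    have "{s \<in> topspace \<sigma>. indicator K s \<in> U} =
      (if 1 \<in> U then K else {}) \<union> (if 0 \<in> U then topspace \<sigma> - K else {})"
      using openin_subset[OF assms(1)] by (auto simp: indicator_def)
    then show ?thesis using assms by auto
  qed
  then show ?thesis by (simp add: continuous_map_def)
qed

lemma indicator_in_C0_functions:
  assumes "Hausdorff_space \<sigma>" "compact_open \<sigma> K"
  shows "indicator K \<in> C0_functions \<sigma>"
proof (rule C0_functionsI)
  show "continuous_map \<sigma> euclidean (indicator K :: 'a \<Rightarrow> complex)"
    using assms by (intro continuous_map_indicator) (auto simp: compact_open_def compactin_imp_closedin)
  show "\<exists>L. compactin \<sigma> L \<and> (\<forall>s\<in>topspace \<sigma>. e \<le> norm (indicator K s :: complex) \<longrightarrow> s \<in> L)"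
    if "e > 0" for e :: real
    using assms that by (intro exI[of _ K]) (auto simp: compact_open_def indicator_def)
qed

text \<open>Continuity is the uniform limit theorem. For decay, an approximant within
  \<open>e / 2\<close> has modulus at least \<open>e / 2\<close> wherever \<open>f\<close> has
  modulus at least \<open>e\<close>, so its compact level set contains that of
  \<open>f\<close>.\<close>

lemma C0_functions_uniform_limit:
  assumes "\<And>e. e > 0 \<Longrightarrow> \<exists>g\<in>C0_functions \<sigma>. \<forall>s\<in>topspace \<sigma>. norm (g s - f s) < e"
  shows "f \<in> C0_functions \<sigma>"
proof (rule C0_functionsI)
  have "\<exists>g. g \<in> C0_functions \<sigma> \<and> (\<forall>s\<in>topspace \<sigma>. norm (g s - f s) < inverse (real (Suc n)))" for n
    using assms[of "inverse (real (Suc n))"] by auto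
  then obtain g where g: "\<And>n. g n \<in> C0_functions \<sigma>"
    "\<And>n s. s \<in> topspace \<sigma> \<Longrightarrow> norm (g n s - f s) < inverse (real (Suc n))"
    by metis
  show "continuous_map \<sigma> euclidean f"
    unfolding mtopology_is_euclidean[symmetric]
  proof (rule Met_TC.continuous_map_uniform_limit[where F = sequentially and f = g])
    show "\<forall>\<^sub>F n in sequentially. continuous_map \<sigma> Met_TC.mtopology (g n)"
      using g(1) by (auto simp: C0_functions_def)
    fix e :: real assume "e > 0"
    then have "\<forall>\<^sub>F n in sequentially. inverse (real (Suc n)) < e"
      by (rule order_tendstoD(2)[OF LIMSEQ_inverse_real_of_nat])
    then show "\<forall>\<^sub>F n in sequentially. \<forall>s\<in>topspace \<sigma>. f s \<in> UNIV \<and> dist (g n s) (f s) < e"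
    proof eventually_elim
      case (elim n)
      then show ?case using g(2)[of _ n] by (force simp: dist_norm)
    qed
  qed simp
  fix e :: real assume "e > 0"
  then obtain h where h: "h \<in> C0_functions \<sigma>" "\<And>s. s \<in> topspace \<sigma> \<Longrightarrow> norm (h s - f s) < e / 2"
    using assms[of "e / 2"] by auto
  have "e / 2 \<le> norm (h s)" if "s \<in> topspace \<sigma>" "e \<le> norm (f s)" for s
    using h(2)[OF that(1)] that(2) norm_triangle_ineq2[of "f s" "h s"]
    by (simp add: norm_minus_commute)
  moreover have "compactin \<sigma> {s \<in> topspace \<sigma>. e / 2 \<le> norm (h s)}"
    using h(1) half_gt_zero[OF \<open>e > 0\<close>] unfolding C0_functions_def by blast
  ultimately show "\<exists>K. compactin \<sigma> K \<and> (\<forall>s\<in>topspace \<sigma>. e \<le> norm (f s) \<longrightarrow> s \<in> K)"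
    by blast
qed

section \<open>Approximation by step functions on compact open sets\<close>

lemma compact_open_UN:
  "finite F \<Longrightarrow> (\<And>i. i \<in> F \<Longrightarrow> compact_open \<sigma> (N i)) \<Longrightarrow> compact_open \<sigma> (\<Union>i\<in>F. N i)"
  by (induction F rule: finite_induct) (simp_all add: compact_open_Un, simp add: compact_open_def)

text \<open>The abstract class \<open>S\<close> turns density of step functions into an induction
  principle: in \<open>representation\<close> it is the set of functions on which two functionals
  agree.\<close>

lemma C0_functions_approx:
  assumes count: "countable (topspace \<sigma>)"
    and lc: "locally_compact_space \<sigma>" and haus: "Hausdorff_space \<sigma>"
    and f: "f \<in> C0_functions \<sigma>" and e: "e > 0"
    and zero: "(\<lambda>_. 0) \<in> S"
    and step: "\<And>g c K. g \<in> S \<Longrightarrow> compact_open \<sigma> K \<Longrightarrow> (\<lambda>s. g s + c * indicator K s) \<in> S"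
  shows "\<exists>g\<in>S. \<forall>s\<in>topspace \<sigma>. norm (f s - g s) < e"
proof -
  have "\<forall>s\<in>topspace \<sigma>. \<exists>K. compact_open \<sigma> K \<and> s \<in> K \<and> (\<forall>t\<in>K. norm (f t - f s) < e)"
  proof
    fix s assume s: "s \<in> topspace \<sigma>"
    have "openin \<sigma> {t \<in> topspace \<sigma>. f t \<in> ball (f s) e}"
      using f by (intro openin_continuous_map_preimage[where Y = euclidean]) (auto simp: C0_functions_def)
    from countable_locally_compact_Hausdorff_compact_open_base[OF count lc haus this, of s]
    obtain K where "compact_open \<sigma> K" "s \<in> K" "K \<subseteq> {t \<in> topspace \<sigma>. f t \<in> ball (f s) e}"
      using s e by auto
    then show "\<exists>K. compact_open \<sigma> K \<and> s \<in> K \<and> (\<forall>t\<in>K. norm (f t - f s) < e)"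
      by (intro exI[of _ K]) (auto simp: dist_norm norm_minus_commute)
  qed
  from bchoice[OF this] obtain N where N: "\<And>s. s \<in> topspace \<sigma> \<Longrightarrow> compact_open \<sigma> (N s)"
    "\<And>s. s \<in> topspace \<sigma> \<Longrightarrow> s \<in> N s"
    "\<And>s t. s \<in> topspace \<sigma> \<Longrightarrow> t \<in> N s \<Longrightarrow> norm (f t - f s) < e"
    by blast
  \<comment> \<open>Outside \<open>?C\<close> the value 0 is already within \<open>e\<close> of
    \<open>f\<close>, so only this compact set has to be covered.\<close>
  let ?C = "{s \<in> topspace \<sigma>. e \<le> norm (f s)}"
  have "compactin \<sigma> ?C" using f e unfolding C0_functions_def by blast
  moreover have "openin \<sigma> U" if "U \<in> N ` ?C" for U
    using that N(1) by (auto simp: compact_open_def)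
  moreover have "?C \<subseteq> \<Union>(N ` ?C)" using N(2) by blast
  ultimately have "\<exists>\<F>. finite \<F> \<and> \<F> \<subseteq> N ` ?C \<and> ?C \<subseteq> \<Union>\<F>"
    by (rule compactinD)
  then obtain \<F> where \<F>: "finite \<F>" "\<F> \<subseteq> N ` ?C" "?C \<subseteq> \<Union>\<F>" by blast
  from finite_subset_image[OF \<F>(1,2)]
  obtain F where F: "F \<subseteq> ?C" "finite F" "\<F> = N ` F" by blast
  have C: "?C \<subseteq> (\<Union>s\<in>F. N s)" using \<F>(3) unfolding F(3) .
  \<comment> \<open>The neighbourhoods are added one at a time. The constant \<open>f s\<close> is
    placed only on the part of \<open>N s\<close> not yet covered, where \<open>g\<close> is still
    0; the second conjunct keeps this true.\<close>
  have "finite F \<Longrightarrow> F \<subseteq> topspace \<sigma> \<Longrightarrow> \<exists>g\<in>S. (\<forall>t \<in> (\<Union>s\<in>F. N s). norm (f t - g t) < e) \<and>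
      (\<forall>t. t \<notin> (\<Union>s\<in>F. N s) \<longrightarrow> g t = 0)"
  proof (induction F rule: finite_induct)
    case empty
    then show ?case using zero by (intro bexI[of _ "\<lambda>_. 0"]) auto
  next
    case (insert s F)
    then obtain g where g: "g \<in> S" "\<And>t. t \<in> (\<Union>s\<in>F. N s) \<Longrightarrow> norm (f t - g t) < e"
      "\<And>t. t \<notin> (\<Union>s\<in>F. N s) \<Longrightarrow> g t = 0"
      by blast
    let ?L = "N s - (\<Union>s\<in>F. N s)"
    have "compact_open \<sigma> ?L"
      using insert N(1) by (intro compact_open_Diff[OF haus] compact_open_UN) auto
    then have "(\<lambda>t. g t + f s * indicator ?L t) \<in> S" by (rule step[OF g(1)])
    moreover have "norm (f t - (g t + f s * indicator ?L t)) < e" if "t \<in> (\<Union>s\<in>insert s F. N s)" for t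
    proof (cases "t \<in> (\<Union>s\<in>F. N s)")
      case True
      then have "indicator ?L t = (0::complex)" by (simp add: indicator_def)
      with g(2)[OF True] show ?thesis by simp
    next
      case False
      then have t: "t \<in> N s" using that by simp
      with False have "indicator ?L t = (1::complex)" by (simp add: indicator_def)
      then show ?thesis using N(3)[OF _ t] g(3)[OF False] insert.prems by simp
    qed
    moreover have "g t + f s * indicator ?L t = 0" if "t \<notin> (\<Union>s\<in>insert s F. N s)" for t
    proof -
      have "t \<notin> (\<Union>s\<in>F. N s)" "t \<notin> N s" using that by simp_all
      with g(3)[of t] show ?thesis by (simp add: indicator_def)
    qed
    ultimately show ?case
      by (intro bexI[of _ "\<lambda>t. g t + f s * indicator ?L t"] conjI ballI allI impI)
  qed
  then obtain g where g: "g \<in> S" "\<And>t. t \<in> (\<Union>s\<in>F. N s) \<Longrightarrow> norm (f t - g t) < e"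
    "\<And>t. t \<notin> (\<Union>s\<in>F. N s) \<Longrightarrow> g t = 0"
    using F by blast
  have "norm (f s - g s) < e" if "s \<in> topspace \<sigma>" for s
  proof (cases "s \<in> (\<Union>s\<in>F. N s)")
    case False
    then have "\<not> e \<le> norm (f s)" using C that by blast
    then show ?thesis using g(3)[OF False] by simp
  qed (rule g(2))
  then show ?thesis using g(1) by blast
qed

section \<open>Bounded functionals on functions vanishing at infinity\<close>

lemma ex_unimodular_mult_eq_norm:
  obtains c :: complex where "norm c = 1" "c * z = of_real (norm z)"
proof (cases "z = 0")
  case False
  have "norm (cnj (sgn z)) = 1" using False by (simp add: norm_sgn)
  moreover have "cnj (sgn z) * z = of_real (norm z)"
    using False complex_norm_square[of z]
    by (simp add: sgn_eq power2_eq_square field_simps)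
  ultimately show ?thesis by (rule that)
qed (use that[of 1] in simp)

lemma ell1_tail_small:
  assumes "e > 0"
  obtains F where "finite F" "\<And>A. A \<inter> F = {} \<Longrightarrow> (\<Sum>\<^sub>\<infinity>s\<in>A. norm (ell1_apply a s)) < e"
proof -
  let ?n = "\<lambda>s. norm (ell1_apply a s)"
  have sm: "?n summable_on A" for A
    by (rule summable_on_subset_banach[OF ell1_abs_summable]) simp
  have "(?n has_sum norm a) UNIV"
    unfolding norm_ell1.rep_eq by (rule has_sum_infsum[OF ell1_abs_summable])
  then obtain F where F: "finite F" "dist (sum ?n F) (norm a) < e"
    using \<open>e > 0\<close> unfolding has_sum_def tendsto_iff eventually_finite_subsets_at_top
    by (metis order_refl subset_UNIV)
  have "infsum ?n A < e" if "A \<inter> F = {}" for A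
  proof -
    have "infsum ?n A + sum ?n F = infsum ?n (A \<union> F)"
      using that F(1) by (subst infsum_Un_disjoint) (auto intro: sm)
    also have "\<dots> \<le> norm a"
      unfolding norm_ell1.rep_eq by (intro infsum_mono_neutral sm) auto
    finally show ?thesis using F(2) by (simp add: dist_real_def)
  qed
  then show ?thesis using that F(1) by blast
qed

text \<open>The functional acts on functions, so that the locale applies both to an element of the
  dual of the predual and to the pairing with a fixed element of \<open>ell1\<close>. Any bound
  \<open>r\<close> stands in for the supremum norm.\<close>

locale C0_functional =
  fixes \<sigma> :: "'a topology" and \<psi> :: "('a \<Rightarrow> complex) \<Rightarrow> complex" and B :: real
  assumes top: "topspace \<sigma> = UNIV"
    and count: "countable (UNIV :: 'a set)"
    and lc: "locally_compact_space \<sigma>" and haus: "Hausdorff_space \<sigma>"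
    and add: "\<And>f g. f \<in> C0_functions \<sigma> \<Longrightarrow> g \<in> C0_functions \<sigma> \<Longrightarrow> \<psi> (\<lambda>s. f s + g s) = \<psi> f + \<psi> g"
    and scale: "\<And>f c. f \<in> C0_functions \<sigma> \<Longrightarrow> \<psi> (\<lambda>s. c * f s) = c * \<psi> f"
    and bound: "\<And>f r. f \<in> C0_functions \<sigma> \<Longrightarrow> (\<And>s. norm (f s) \<le> r) \<Longrightarrow> norm (\<psi> f) \<le> B * r"
begin

text \<open>For open \<open>A\<close> this is the total variation of \<open>A\<close> under the
  measure that represents \<open>\<psi>\<close>.\<close>

definition variation :: "'a set \<Rightarrow> real" where
  "variation A = (SUP f\<in>{f \<in> C0_functions \<sigma>. \<forall>s. norm (f s) \<le> indicator A s}. norm (\<psi> f))"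

text \<open>The total variation of the point \<open>s\<close>, taken from outside:
  \<open>variation {s}\<close> is 0 whenever \<open>s\<close> is not isolated, as no nonzero
  continuous function is supported in \<open>{s}\<close>.\<close>

definition atom :: "'a \<Rightarrow> real" where
  "atom s = (INF K\<in>{K. compact_open \<sigma> K \<and> s \<in> K}. variation K)"

section \<open>Monotonicity and superadditivity of the variation\<close>

lemma bound_unit: "f \<in> C0_functions \<sigma> \<Longrightarrow> \<forall>s. norm (f s) \<le> indicator A s \<Longrightarrow> norm (\<psi> f) \<le> B"
  using bound[of f 1] by (smt (verit) indicator_le_1 mult.right_neutral)

lemma variation_upper:
  "f \<in> C0_functions \<sigma> \<Longrightarrow> (\<And>s. norm (f s) \<le> indicator A s) \<Longrightarrow> norm (\<psi> f) \<le> variation A"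
  unfolding variation_def
  by (rule cSUP_upper) (auto intro!: bdd_aboveI2[where M = B] bound_unit)

lemma variation_least:
  assumes "\<And>f. f \<in> C0_functions \<sigma> \<Longrightarrow> \<forall>s. norm (f s) \<le> indicator A s \<Longrightarrow> norm (\<psi> f) \<le> r"
  shows "variation A \<le> r"
  unfolding variation_def
proof (rule cSUP_least)
  have "(\<lambda>_. 0) \<in> {f \<in> C0_functions \<sigma>. \<forall>s. norm (f s) \<le> indicator A s}"
    by (simp add: C0_functions_zero)
  then show "{f \<in> C0_functions \<sigma>. \<forall>s. norm (f s) \<le> indicator A s} \<noteq> {}" by blast
qed (use assms in auto)

lemma variation_le: "variation A \<le> B"
  by (rule variation_least) (rule bound_unit)

lemma variation_nonneg: "0 \<le> variation A"
  using order_trans[OF norm_ge_zero variation_upper[of "\<lambda>_. 0"]] by (simp add: C0_functions_zero)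

text \<open>Unimodular factors turn both values of \<open>\<psi>\<close> into their moduli. Since
  the sets are disjoint, the rotated sum is still dominated by the indicator of the union, and its
  value is the sum of the moduli.\<close>

lemma variation_superadditive:
  assumes "A \<inter> A' = {}"
  shows "variation A + variation A' \<le> variation (A \<union> A')"
proof -
  have *: "norm (\<psi> f) + norm (\<psi> g) \<le> variation (A \<union> A')"
    if f: "f \<in> C0_functions \<sigma>" "\<forall>s. norm (f s) \<le> indicator A s"
      and g: "g \<in> C0_functions \<sigma>" "\<forall>s. norm (g s) \<le> indicator A' s" for f g
  proof -
    obtain c d where c: "norm c = 1" "c * \<psi> f = of_real (norm (\<psi> f))"
      and d: "norm d = 1" "d * \<psi> g = of_real (norm (\<psi> g))"
      using ex_unimodular_mult_eq_norm by metis
    have "norm (c * f s + d * g s) \<le> indicator (A \<union> A') s" for s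
    proof -
      have "norm (c * f s + d * g s) \<le> norm (f s) + norm (g s)"
        using norm_triangle_ineq[of "c * f s" "d * g s"] by (simp add: norm_mult c d)
      also have "\<dots> \<le> indicator A s + indicator A' s"
        using f(2) g(2) by (intro add_mono) auto
      also have "\<dots> = indicator (A \<union> A') s"
        using assms by (auto simp: indicator_def)
      finally show ?thesis .
    qed
    then have "norm (\<psi> (\<lambda>s. c * f s + d * g s)) \<le> variation (A \<union> A')"
      by (intro variation_upper C0_functions_add C0_functions_scale f g)
    also have "\<psi> (\<lambda>s. c * f s + d * g s) = of_real (norm (\<psi> f) + norm (\<psi> g))"
      by (simp add: add scale C0_functions_scale f g c d)
    finally show ?thesis by (simp only: norm_of_real)
  qed
  \<comment> \<open>The two suprema are taken in turn, first over \<open>g\<close> with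
    \<open>f\<close> fixed and then over \<open>f\<close>.\<close>
  have "norm (\<psi> f) \<le> variation (A \<union> A') - variation A'"
    if f: "f \<in> C0_functions \<sigma>" "\<forall>s. norm (f s) \<le> indicator A s" for f
  proof -
    have "variation A' \<le> variation (A \<union> A') - norm (\<psi> f)"
    proof (rule variation_least)
      fix g assume "g \<in> C0_functions \<sigma>" "\<forall>s. norm (g s) \<le> indicator A' s"
      from *[OF f this] show "norm (\<psi> g) \<le> variation (A \<union> A') - norm (\<psi> f)" by simp
    qed
    then show ?thesis by simp
  qed
  then have "variation A \<le> variation (A \<union> A') - variation A'"
    by (rule variation_least)
  then show ?thesis by simp
qed

lemma variation_Diff: "A \<subseteq> A' \<Longrightarrow> variation A + variation (A' - A) \<le> variation A'"
  using variation_superadditive[of A "A' - A"] by (simp add: Un_absorb1)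

lemma variation_mono: "A \<subseteq> A' \<Longrightarrow> variation A \<le> variation A'"
  using variation_Diff[of A A'] variation_nonneg[of "A' - A"] by simp

section \<open>Atoms of the variation\<close>

lemma compact_open_base:
  assumes "openin \<sigma> U" "s \<in> U"
  obtains K where "compact_open \<sigma> K" "s \<in> K" "K \<subseteq> U"
  using countable_locally_compact_Hausdorff_compact_open_base[OF _ lc haus assms] count top by auto

lemma compact_open_nhd:
  obtains K where "compact_open \<sigma> K" "s \<in> K"
  using compact_open_base[of UNIV s] top openin_topspace[of \<sigma>] by auto

lemma atom_le: "compact_open \<sigma> K \<Longrightarrow> s \<in> K \<Longrightarrow> atom s \<le> variation K"
  unfolding atom_def by (rule cINF_lower) (auto intro!: bdd_belowI2[where m = 0] variation_nonneg)

lemma atom_approx: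
  assumes "e > 0"
  obtains K where "compact_open \<sigma> K" "s \<in> K" "variation K < atom s + e"
proof -
  have "{K. compact_open \<sigma> K \<and> s \<in> K} \<noteq> {}"
    using compact_open_nhd[of s] by blast
  then have "\<exists>K\<in>{K. compact_open \<sigma> K \<and> s \<in> K}. variation K < atom s + e"
    using assms by (subst cINF_less_iff[symmetric])
      (auto simp: atom_def intro!: bdd_belowI2[where m = 0] variation_nonneg)
  then show ?thesis using that by blast
qed

text \<open>A compact open \<open>K\<close> separates \<open>s\<close> from the other points. It
  accounts for \<open>atom s\<close>, and the smaller open set \<open>U - K\<close> for the rest;
  hence the induction over all \<open>U\<close>.\<close>

lemma sum_atom_le:
  "finite F \<Longrightarrow> F \<subseteq> U \<Longrightarrow> openin \<sigma> U \<Longrightarrow> (\<Sum>s\<in>F. atom s) \<le> variation U"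
proof (induction F arbitrary: U rule: finite_induct)
  case (insert s F)
  have "closedin \<sigma> F"
    using insert(1) haus by (intro closedin_Hausdorff_finite) (auto simp: top)
  then have "openin \<sigma> (U - F)" "s \<in> U - F" using insert by auto
  then obtain K where K: "compact_open \<sigma> K" "s \<in> K" "K \<subseteq> U - F"
    by (rule compact_open_base)
  then have "openin \<sigma> (U - K)"
    using insert.prems compactin_imp_closedin[OF haus] by (auto simp: compact_open_def)
  have KU: "K \<subseteq> U" using K(3) by blast
  have "F \<subseteq> U - K" using K(3) insert.prems by blast
  then have "(\<Sum>s\<in>F. atom s) \<le> variation (U - K)"
    using \<open>openin \<sigma> (U - K)\<close> by (rule insert.IH)
  then show ?case
    using atom_le[OF K(1,2)] variation_Diff[OF KU] insert.hyps by simp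
qed (simp add: variation_nonneg)

section \<open>Values on indicators and point masses\<close>

lemma indicator_C0: "compact_open \<sigma> K \<Longrightarrow> indicator K \<in> C0_functions \<sigma>"
  by (rule indicator_in_C0_functions[OF haus])

lemma indicator_additive:
  assumes "compact_open \<sigma> K" "compact_open \<sigma> L" "K \<inter> L = {}"
  shows "\<psi> (indicator (K \<union> L)) = \<psi> (indicator K) + \<psi> (indicator L)"
proof -
  have "indicator (K \<union> L) = (\<lambda>s. indicator K s + indicator L s :: complex)"
    using assms(3) by (auto simp: indicator_def fun_eq_iff)
  then show ?thesis using add[OF indicator_C0[OF assms(1)] indicator_C0[OF assms(2)]] by simp
qed

lemma norm_indicator_le: "compact_open \<sigma> K \<Longrightarrow> norm (\<psi> (indicator K)) \<le> variation K"
  by (rule variation_upper[OF indicator_C0]) (auto simp: indicator_def)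

text \<open>As compact open sets shrink to \<open>s\<close>, their variations decrease to
  \<open>atom s\<close>; by this estimate the values on their indicators form a Cauchy net.\<close>

lemma indicator_diff_le:
  assumes K: "compact_open \<sigma> K" and L: "compact_open \<sigma> L" and sub: "K \<subseteq> L"
  shows "norm (\<psi> (indicator L) - \<psi> (indicator K)) \<le> variation L - variation K"
proof -
  have D: "compact_open \<sigma> (L - K)" by (rule compact_open_Diff[OF haus L K])
  have "K \<union> (L - K) = L" using sub by blast
  then have "\<psi> (indicator L) - \<psi> (indicator K) = \<psi> (indicator (L - K))"
    using indicator_additive[OF K D] by simp
  then show ?thesis
    using norm_indicator_le[OF D] variation_Diff[OF sub] by simp
qed

text \<open>The limit of that Cauchy net is found as a common point of the closed discs
  \<open>?b K\<close>, by compactness and the finite intersection property.\<close>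

lemma ex_point_mass:
  "\<exists>z. norm z \<le> atom s \<and>
    (\<forall>K. compact_open \<sigma> K \<longrightarrow> s \<in> K \<longrightarrow> norm (\<psi> (indicator K) - z) \<le> variation K - atom s)"
proof -
  let ?N = "{K. compact_open \<sigma> K \<and> s \<in> K}"
  let ?b = "\<lambda>K. cball (\<psi> (indicator K)) (variation K - atom s)"
  have "\<Inter>(?b ` ?N) \<noteq> {}"
  proof (rule compact_fip_Heine_Borel)
    fix \<F> assume "finite \<F>" "\<F> \<subseteq> ?b ` ?N"
    from finite_subset_image[OF this]
    obtain \<K> where \<K>: "\<K> \<subseteq> ?N" "finite \<K>" "\<F> = ?b ` \<K>" by metis
    \<comment> \<open>A compact open neighbourhood below all members of the finite family: the value
      at its indicator lies in all their discs, as \<open>variation L\<close> is at least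
      \<open>atom s\<close>.\<close>
    have "\<exists>L. compact_open \<sigma> L \<and> s \<in> L \<and> (\<forall>K\<in>\<K>. L \<subseteq> K)"
      using \<K>(2,1)
    proof (induction \<K> rule: finite_induct)
      case empty
      then show ?case using compact_open_nhd[of s] by auto
    next
      case (insert K \<K>)
      then obtain L where "compact_open \<sigma> L" "s \<in> L" "\<forall>K\<in>\<K>. L \<subseteq> K" by auto
      then show ?case
        using insert.prems by (intro exI[of _ "K \<inter> L"]) (auto intro: compact_open_Int[OF haus])
    qed
    then obtain L where L: "compact_open \<sigma> L" "s \<in> L" "\<And>K. K \<in> \<K> \<Longrightarrow> L \<subseteq> K" by blast
    have "\<psi> (indicator L) \<in> ?b K" if "K \<in> \<K>" for K
    proof -
      have "compact_open \<sigma> K" using that \<K>(1) by blast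
      from indicator_diff_le[OF L(1) this L(3)[OF that]] show ?thesis
        using atom_le[OF L(1,2)] by (simp add: dist_norm)
    qed
    then show "\<Inter>\<F> \<noteq> {}" using \<K>(3) by blast
  qed auto
  then obtain z where "z \<in> \<Inter>(?b ` ?N)" unfolding ex_in_conv[symmetric] by (rule exE)
  then have z: "norm (\<psi> (indicator K) - z) \<le> variation K - atom s"
    if "compact_open \<sigma> K" "s \<in> K" for K
    using that by (auto simp: dist_norm)
  have "norm z \<le> atom s"
  proof (rule field_le_epsilon)
    fix e :: real assume "e > 0"
    \<comment> \<open>\<open>e / 2\<close> because \<open>variation K\<close> is used twice, once to
      bound the centre of the disc and once in its radius.\<close>
    then obtain K where K: "compact_open \<sigma> K" "s \<in> K" "variation K < atom s + e / 2"
      using atom_approx[of "e / 2"] by auto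
    have "norm z \<le> norm (\<psi> (indicator K)) + norm (\<psi> (indicator K) - z)"
      by (metis norm_triangle_sub norm_minus_commute)
    then show "norm z \<le> atom s + e"
      using z[OF K(1,2)] norm_indicator_le[OF K(1)] K(3) by simp
  qed
  with z show ?thesis by blast
qed

text \<open>The mass that the representing measure gives to \<open>s\<close>. The radii become
  arbitrarily small by \<open>atom_approx\<close>, so there is only one such
  \<open>z\<close>.\<close>

definition point_mass :: "'a \<Rightarrow> complex" where
  "point_mass s = (SOME z. norm z \<le> atom s \<and>
    (\<forall>K. compact_open \<sigma> K \<longrightarrow> s \<in> K \<longrightarrow> norm (\<psi> (indicator K) - z) \<le> variation K - atom s))"

lemma norm_point_mass: "norm (point_mass s) \<le> atom s"
  and point_mass_approx: "compact_open \<sigma> K \<Longrightarrow> s \<in> K \<Longrightarrow>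
    norm (\<psi> (indicator K) - point_mass s) \<le> variation K - atom s"
  using someI_ex[OF ex_point_mass[of s]] unfolding point_mass_def by blast+

text \<open>The constant is exactly \<open>B\<close>: this is what later makes the canonical map
  isometric.\<close>

lemma sum_point_mass_le:
  assumes "finite F"
  shows "(\<Sum>s\<in>F. norm (point_mass s)) \<le> B"
proof -
  have "openin \<sigma> UNIV" using openin_topspace[of \<sigma>] by (simp add: top)
  have "(\<Sum>s\<in>F. norm (point_mass s)) \<le> (\<Sum>s\<in>F. atom s)"
    by (intro sum_mono norm_point_mass)
  also have "\<dots> \<le> variation UNIV"
    by (rule sum_atom_le[OF assms subset_UNIV \<open>openin \<sigma> UNIV\<close>])
  also have "\<dots> \<le> B" by (rule variation_le)
  finally show ?thesis .
qed

section \<open>The representing element of \<open>ell1\<close> and the vanishing of the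
  defect\<close>

definition mass :: "'a ell1" where
  "mass = Abs_ell1 point_mass"

lemma mass_apply: "ell1_apply mass = point_mass"
proof -
  have "(\<lambda>s. norm (point_mass s)) summable_on UNIV"
    unfolding abs_summable_iff_bdd_above
    by (intro bdd_aboveI2[where M = B]) (auto intro: sum_point_mass_le)
  then show ?thesis by (simp add: mass_def Abs_ell1_inverse)
qed

lemma norm_mass: "norm mass \<le> B"
  by (rule norm_ell1_le) (simp add: mass_apply sum_point_mass_le)

text \<open>The estimate must hold for every compact open subset of \<open>K\<close>, because a
  cover is later cut into disjoint pieces. Such an \<open>L\<close> has value near
  \<open>point_mass s\<close> if it contains \<open>s\<close>, and near 0 otherwise.\<close>

lemma small_near_point:
  assumes "e > 0"
  obtains K where "compact_open \<sigma> K" "s \<in> K"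
    "\<And>L. compact_open \<sigma> L \<Longrightarrow> L \<subseteq> K \<Longrightarrow> norm (\<psi> (indicator L) - (\<Sum>\<^sub>\<infinity>s\<in>L. point_mass s)) \<le> e"
proof -
  have e2: "e / 2 > 0" using assms by simp
  obtain F where F: "finite F" "\<And>A. A \<inter> F = {} \<Longrightarrow> (\<Sum>\<^sub>\<infinity>s\<in>A. norm (point_mass s)) < e / 2"
    using ell1_tail_small[OF e2, of mass] unfolding mass_apply by blast
  obtain K1 where K1: "compact_open \<sigma> K1" "s \<in> K1" "variation K1 < atom s + e / 2"
    using atom_approx[OF e2] .
  \<comment> \<open>\<open>K2\<close> excludes every point that carries much of \<open>mass\<close>,
    except possibly \<open>s\<close> itself.\<close>
  have "closedin \<sigma> (F - {s})"
    using F(1) haus by (intro closedin_Hausdorff_finite) (auto simp: top)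
  then have "openin \<sigma> (UNIV - (F - {s}))" "s \<in> UNIV - (F - {s})"
    by (auto simp: closedin_def top)
  then obtain K2 where K2: "compact_open \<sigma> K2" "s \<in> K2" "K2 \<subseteq> UNIV - (F - {s})"
    by (rule compact_open_base)
  have sm: "(\<lambda>s. norm (point_mass s)) summable_on A" for A
    using summable_on_subset_banach[OF ell1_abs_summable[of mass]] by (simp add: mass_apply)
  have tail: "norm (\<Sum>\<^sub>\<infinity>s\<in>A. point_mass s) < e / 2" if "A \<inter> F = {}" for A
    using norm_infsum_bound[OF sm, of A] F(2)[OF that] by simp
  have K: "compact_open \<sigma> (K1 \<inter> K2)" "s \<in> K1 \<inter> K2"
    using K1 K2 by (auto intro: compact_open_Int[OF haus])
  have V: "variation (K1 \<inter> K2) < atom s + e / 2"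
    using variation_mono[of "K1 \<inter> K2" K1] K1(3) by simp
  have "norm (\<psi> (indicator L) - (\<Sum>\<^sub>\<infinity>s\<in>L. point_mass s)) \<le> e"
    if L: "compact_open \<sigma> L" "L \<subseteq> K1 \<inter> K2" for L
  proof (cases "s \<in> L")
    case True
    have "(\<Sum>\<^sub>\<infinity>t\<in>L. point_mass t) = (\<Sum>\<^sub>\<infinity>t\<in>{s} \<union> (L - {s}). point_mass t)"
      using True by (simp add: insert_absorb)
    also have "\<dots> = point_mass s + (\<Sum>\<^sub>\<infinity>t\<in>L - {s}. point_mass t)"
      by (subst infsum_Un_disjoint) (auto intro: abs_summable_summable[OF sm])
    finally have eq: "\<psi> (indicator L) - (\<Sum>\<^sub>\<infinity>t\<in>L. point_mass t)
        = (\<psi> (indicator L) - point_mass s) - (\<Sum>\<^sub>\<infinity>t\<in>L - {s}. point_mass t)"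
      by simp
    have "norm (\<Sum>\<^sub>\<infinity>t\<in>L - {s}. point_mass t) < e / 2"
      by (rule tail) (use L(2) K2(3) in blast)
    moreover have "norm (\<psi> (indicator L) - point_mass s) < e / 2"
      using point_mass_approx[OF L(1) True] variation_mono[OF L(2)] V by simp
    ultimately show ?thesis
      unfolding eq using norm_triangle_ineq4 by (smt (verit) field_sum_of_halves)
  next
    case False
    have "norm (\<Sum>\<^sub>\<infinity>t\<in>L. point_mass t) < e / 2"
      by (rule tail) (use False L(2) K2(3) in blast)
    \<comment> \<open>\<open>K1 \<inter> K2 - L\<close> is a neighbourhood of \<open>s\<close> and
      so takes up \<open>atom s\<close>, which leaves \<open>L\<close> a variation below
      \<open>e / 2\<close>.\<close>
    moreover have "atom s \<le> variation (K1 \<inter> K2 - L)"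
      using K False by (intro atom_le compact_open_Diff[OF haus K(1) L(1)]) auto
    then have "norm (\<psi> (indicator L)) < e / 2"
      using norm_indicator_le[OF L(1)] variation_Diff[OF L(2)] V by simp
    ultimately show ?thesis
      using norm_triangle_ineq4 by (smt (verit) field_sum_of_halves)
  qed
  then show ?thesis using that K by blast
qed

text \<open>Compactness reduces the cover to finitely many sets, but which ones is not known
  beforehand. Countability lets every point receive its own tolerance in advance with a finite
  total, so any finite subcover gives a defect of order \<open>e\<close>.\<close>

lemma indicator_representation:
  assumes K: "compact_open \<sigma> K"
  shows "\<psi> (indicator K) = (\<Sum>\<^sub>\<infinity>s\<in>K. point_mass s)"
proof -
  define d where "d L = \<psi> (indicator L) - (\<Sum>\<^sub>\<infinity>s\<in>L. point_mass s)" for L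
  have sm: "point_mass summable_on A" for A
    using abs_summable_summable[OF summable_on_subset_banach[OF ell1_abs_summable[of mass]]]
    by (simp add: mass_apply)
  have d_Un: "d (L \<union> M) = d L + d M"
    if "compact_open \<sigma> L" "compact_open \<sigma> M" "L \<inter> M = {}" for L M
    using that by (simp add: d_def indicator_additive infsum_Un_disjoint sm)
  have empty: "compact_open \<sigma> {}" by (simp add: compact_open_def)
  have d_empty: "d {} = 0" using d_Un[OF empty empty] by simp
  have "norm (d K) \<le> 2 * e" if "e > 0" for e
  proof -
    \<comment> \<open>The enumeration starts at 0, so these weights add up to at most
      \<open>2 * e\<close>.\<close>
    let ?w = "\<lambda>s::'a. e * (1 / 2) ^ to_nat_on UNIV s"
    have "\<exists>N. compact_open \<sigma> N \<and> s \<in> N \<and> (\<forall>L. compact_open \<sigma> L \<longrightarrow> L \<subseteq> N \<longrightarrow> norm (d L) \<le> ?w s)" for s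
      unfolding d_def using small_near_point[of "?w s" s] \<open>e > 0\<close> by (metis zero_less_divide_1_iff
        zero_less_mult_iff zero_less_numeral zero_less_power)
    then obtain N where N: "\<And>s. compact_open \<sigma> (N s)" "\<And>s. s \<in> N s"
      "\<And>s L. compact_open \<sigma> L \<Longrightarrow> L \<subseteq> N s \<Longrightarrow> norm (d L) \<le> ?w s"
      by metis
    \<comment> \<open>\<open>L\<close> is cut along \<open>N s\<close>: the part inside falls under
      the tolerance of \<open>s\<close>, the rest is covered by the remaining sets, and
      \<open>d\<close> is additive.\<close>
    have *: "norm (d L) \<le> (\<Sum>s\<in>F. ?w s)"
      if "finite F" "compact_open \<sigma> L" "L \<subseteq> (\<Union>s\<in>F. N s)" for F L
      using that
    proof (induction F arbitrary: L rule: finite_induct)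
      case empty
      then show ?case by (simp add: d_empty)
    next
      case (insert s F)
      have L: "compact_open \<sigma> (L \<inter> N s)" "compact_open \<sigma> (L - N s)"
        using insert.prems(1) N(1) by (auto intro: compact_open_Int[OF haus] compact_open_Diff[OF haus])
      have "norm (d (L - N s)) \<le> (\<Sum>s\<in>F. ?w s)"
        using insert.prems(2) by (intro insert.IH[OF L(2)]) auto
      moreover have "norm (d (L \<inter> N s)) \<le> ?w s" by (rule N(3)[OF L(1)]) simp
      moreover have "d L = d (L \<inter> N s) + d (L - N s)"
        using d_Un[OF L] by (simp add: Un_commute[of "L \<inter> N s"] Un_Diff_Int Int_Diff_disjoint)
      ultimately show ?case
        using norm_triangle_ineq[of "d (L \<inter> N s)" "d (L - N s)"] insert.hyps by simp
    qed
    have "compactin \<sigma> K" using K by (simp add: compact_open_def)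
    moreover have "openin \<sigma> U" if "U \<in> range N" for U
      using that N(1) by (auto simp: compact_open_def)
    moreover have "K \<subseteq> \<Union>(range N)" using N(2) by blast
    ultimately have "\<exists>\<F>. finite \<F> \<and> \<F> \<subseteq> range N \<and> K \<subseteq> \<Union>\<F>"
      by (rule compactinD)
    then obtain \<F> where \<F>: "finite \<F>" "\<F> \<subseteq> range N" "K \<subseteq> \<Union>\<F>" by blast
    from finite_subset_image[OF \<F>(1,2)] \<F>(3)
    obtain F where F: "finite F" "K \<subseteq> (\<Union>s\<in>F. N s)" by metis
    have inj: "inj_on (to_nat_on (UNIV::'a set)) F"
      using inj_on_to_nat_on[OF count] by (rule inj_on_subset) simp
    have "(\<Sum>s\<in>F. ?w s) = e * (\<Sum>n\<in>to_nat_on UNIV ` F. (1 / 2) ^ n)"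
      by (simp add: sum.reindex[OF inj] sum_distrib_left)
    also have "\<dots> \<le> e * (\<Sum>n. (1 / 2) ^ n)"
      using F(1) \<open>e > 0\<close> by (intro mult_left_mono sum_le_suminf) (auto intro: summable_geometric)
    also have "\<dots> = 2 * e" by (simp add: suminf_geometric)
    finally show ?thesis using *[OF F(1) K F(2)] by simp
  qed
  then have "norm (d K) \<le> e" if "e > 0" for e
    using that half_gt_zero[OF that] by fastforce
  then have "norm (d K) \<le> 0" using field_le_epsilon[of "norm (d K)" 0] by simp
  then show ?thesis by (simp add: d_def)
qed

text \<open>Both sides agree on step functions, and each changes by at most \<open>B * e\<close>
  under a perturbation of size \<open>e\<close>; density then gives equality.\<close>

lemma representation:
  assumes f: "f \<in> C0_functions \<sigma>"
  shows "\<psi> f = (\<Sum>\<^sub>\<infinity>s. f s * ell1_apply mass s)"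
proof -
  define P where "P g = (\<Sum>\<^sub>\<infinity>s. g s * ell1_apply mass s)" for g
  have sm: "(\<lambda>s. g s * ell1_apply mass s) summable_on UNIV" if "g \<in> C0_functions \<sigma>" for g
    by (rule abs_summable_summable[OF pairing_abs_summable[OF bounded_C0_functions[OF that top]]])
  have P_add: "P (\<lambda>s. g s + h s) = P g + P h" if "g \<in> C0_functions \<sigma>" "h \<in> C0_functions \<sigma>" for g h
    by (simp add: P_def distrib_right infsum_add sm that)
  have P_scale: "P (\<lambda>s. c * g s) = c * P g" for c g
    by (simp add: P_def mult.assoc infsum_cmult_right')
  have P_ind: "P (indicator K) = (\<Sum>\<^sub>\<infinity>s\<in>K. point_mass s)" for K
    unfolding P_def mass_apply by (rule infsum_cong_neutral) (auto simp: indicator_def)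
  let ?S = "{g \<in> C0_functions \<sigma>. \<psi> g = P g}"
  have B: "B \<ge> 0" using order_trans[OF norm_ge_zero norm_mass] .
  have le: "norm (\<psi> f - P f) \<le> 2 * B * e" if e: "e > 0" for e
  proof -
    have "countable (topspace \<sigma>)" by (simp add: top count)
    moreover have "\<psi> (\<lambda>_. 0) = 0" using scale[OF C0_functions_zero, of 0] by simp
    then have "(\<lambda>_. 0) \<in> ?S" by (simp add: C0_functions_zero P_def)
    moreover have "(\<lambda>s. g s + c * indicator K s) \<in> ?S" if g: "g \<in> ?S" and K: "compact_open \<sigma> K" for g c K
    proof -
      note c = indicator_C0[OF K] C0_functions_scale[OF indicator_C0[OF K], of c]
      show ?thesis
        using g c by (simp add: add scale P_add P_scale P_ind C0_functions_add indicator_representation[OF K])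
    qed
    ultimately have "\<exists>g\<in>?S. \<forall>s\<in>topspace \<sigma>. norm (f s - g s) < e"
      by (rule C0_functions_approx[OF _ lc haus f e])
    then obtain g where g: "g \<in> ?S" "\<And>s. norm (f s - g s) < e"
      using top by auto
    \<comment> \<open>The difference is spelled as a sum with a multiple so that \<open>add\<close>
      and \<open>scale\<close> apply.\<close>
    let ?h = "\<lambda>s. f s + - 1 * g s"
    have g': "(\<lambda>s. - 1 * g s) \<in> C0_functions \<sigma>" using g(1) by (intro C0_functions_scale) simp
    then have h: "?h \<in> C0_functions \<sigma>" by (rule C0_functions_add[OF f])
    have he: "norm (?h s) \<le> e" for s using g(2)[of s] by simp
    have "\<psi> f - P f = \<psi> ?h - P ?h"
      unfolding add[OF f g'] P_add[OF f g'] P_scale using g(1) scale[of g "- 1"] by simp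
    also have "norm \<dots> \<le> norm (\<psi> ?h) + norm (P ?h)" by (rule norm_triangle_ineq4)
    also have "\<dots> \<le> B * e + e * norm mass"
      unfolding P_def by (intro add_mono bound[OF h] pairing_norm_le he)
    also have "\<dots> \<le> B * e + e * B" using e norm_mass by simp
    finally show ?thesis by simp
  qed
  have "norm (\<psi> f - P f) \<le> 0"
  proof (rule field_le_epsilon)
    fix e :: real assume "e > 0"
    \<comment> \<open>The 1 in the denominator covers \<open>B = 0\<close>.\<close>
    then have "norm (\<psi> f - P f) \<le> 2 * B * (e / (2 * B + 1))"
      using B by (intro le) (simp add: add_nonneg_pos)
    also have "\<dots> \<le> e" using B \<open>e > 0\<close> by (simp add: field_simps)
    finally show "norm (\<psi> f - P f) \<le> 0 + e" by simp
  qed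
  then show ?thesis by (simp add: P_def)
qed

end

section \<open>The predual\<close>

text \<open>This is injectivity of the canonical map. The test function is the indicator of a
  compact open neighbourhood of \<open>s\<close> avoiding the other points that carry most of
  \<open>a\<close>; it yields the coefficient at \<open>s\<close> up to a small tail.\<close>

lemma C0_pairing_eq_zero_imp:
  fixes a :: "'a ell1"
  assumes top: "topspace \<sigma> = UNIV" and count: "countable (UNIV :: 'a set)"
    and lc: "locally_compact_space \<sigma>" and haus: "Hausdorff_space \<sigma>"
    and zero: "\<And>f. f \<in> C0_functions \<sigma> \<Longrightarrow> (\<Sum>\<^sub>\<infinity>s. f s * ell1_apply a s) = 0"
  shows "a = 0"
proof (rule ell1_eqI)
  fix s
  have sm: "(\<lambda>s. norm (ell1_apply a s)) summable_on A" for A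
    by (rule summable_on_subset_banach[OF ell1_abs_summable]) simp
  have "norm (ell1_apply a s) \<le> 0"
  proof (rule field_le_epsilon)
    fix e :: real assume "e > 0"
    then obtain F where F: "finite F" "\<And>A. A \<inter> F = {} \<Longrightarrow> (\<Sum>\<^sub>\<infinity>s\<in>A. norm (ell1_apply a s)) < e"
      using ell1_tail_small by metis
    have "closedin \<sigma> (F - {s})"
      using F(1) haus by (intro closedin_Hausdorff_finite) (auto simp: top)
    then have "openin \<sigma> (UNIV - (F - {s}))" "s \<in> UNIV - (F - {s})"
      by (auto simp: closedin_def top)
    moreover have "countable (topspace \<sigma>)" by (simp add: top count)
    ultimately obtain K where K: "compact_open \<sigma> K" "s \<in> K" "K \<subseteq> UNIV - (F - {s})"
      using countable_locally_compact_Hausdorff_compact_open_base[OF _ lc haus] by metis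
    have "0 = (\<Sum>\<^sub>\<infinity>t. indicator K t * ell1_apply a t)"
      using zero[OF indicator_in_C0_functions[OF haus K(1)]] by simp
    also have "\<dots> = (\<Sum>\<^sub>\<infinity>t\<in>{s} \<union> (K - {s}). ell1_apply a t)"
      using K(2) by (intro infsum_cong_neutral) (auto simp: indicator_def)
    also have "\<dots> = ell1_apply a s + (\<Sum>\<^sub>\<infinity>t\<in>K - {s}. ell1_apply a t)"
      by (subst infsum_Un_disjoint) (auto intro: abs_summable_summable[OF sm])
    finally have "norm (ell1_apply a s) = norm (\<Sum>\<^sub>\<infinity>t\<in>K - {s}. ell1_apply a t)"
      by (metis add_eq_0_iff norm_minus_cancel)
    also have "\<dots> \<le> (\<Sum>\<^sub>\<infinity>t\<in>K - {s}. norm (ell1_apply a t))"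
      by (rule norm_infsum_bound[OF sm])
    also have "\<dots> < e" by (rule F(2)) (use K(3) in blast)
    finally show "norm (ell1_apply a s) \<le> 0 + e" by simp
  qed
  then show "ell1_apply a s = ell1_apply 0 s" by (simp add: zero_ell1.rep_eq)
qed

text \<open>The pairing with \<open>a\<close> is itself a bounded functional, so the construction
  represents it by \<open>mass\<close>, of norm at most \<open>B\<close>. Injectivity identifies
  \<open>mass\<close> with \<open>a\<close>.\<close>

lemma norm_ell1_le_C0:
  fixes a :: "'a ell1"
  assumes top: "topspace \<sigma> = UNIV" and count: "countable (UNIV :: 'a set)"
    and lc: "locally_compact_space \<sigma>" and haus: "Hausdorff_space \<sigma>"
    and le: "\<And>f r. f \<in> C0_functions \<sigma> \<Longrightarrow> (\<And>s. norm (f s) \<le> r) \<Longrightarrow>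
      norm (\<Sum>\<^sub>\<infinity>s. f s * ell1_apply a s) \<le> B * r"
  shows "norm a \<le> B"
proof -
  have sm: "(\<lambda>s. f s * ell1_apply b s) summable_on UNIV" if "f \<in> C0_functions \<sigma>" for f b
    by (rule abs_summable_summable[OF pairing_abs_summable[OF bounded_C0_functions[OF that top]]])
  interpret C0_functional \<sigma> "\<lambda>f. \<Sum>\<^sub>\<infinity>s. f s * ell1_apply a s" B
    by unfold_locales
      (simp_all add: assms distrib_right infsum_add sm mult.assoc infsum_cmult_right')
  have "(\<Sum>\<^sub>\<infinity>s. f s * ell1_apply (a - mass) s) = 0" if "f \<in> C0_functions \<sigma>" for f
  proof -
    have "(\<Sum>\<^sub>\<infinity>s. f s * ell1_apply (a - mass + mass) s)
        = (\<Sum>\<^sub>\<infinity>s. f s * ell1_apply (a - mass) s) + (\<Sum>\<^sub>\<infinity>s. f s * ell1_apply mass s)"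
      unfolding plus_ell1.rep_eq distrib_left by (rule infsum_add[OF sm[OF that] sm[OF that]])
    then show ?thesis using representation[OF that] by simp
  qed
  then have "a - mass = 0" by (rule C0_pairing_eq_zero_imp[OF top count lc haus])
  then show ?thesis using norm_mass by simp
qed

section \<open>Closedness and module structure of the image of \<open>C0_functions\<close>\<close>

lemma C0_functionals_iff:
  fixes \<phi> :: "'a::semigroup_mult ell1 \<Rightarrow>\<^sub>L complex"
  assumes top: "topspace \<sigma> = UNIV"
  shows "\<phi> \<in> linfty_functional ` C0_functions \<sigma> \<longleftrightarrow>
    \<phi> \<in> cdual \<and> (\<lambda>s. \<phi> (delta s)) \<in> C0_functions \<sigma>"
proof safe
  assume *: "\<phi> \<in> cdual" "(\<lambda>s. \<phi> (delta s)) \<in> C0_functions \<sigma>"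
  have "\<phi> = linfty_functional (\<lambda>s. \<phi> (delta s))"
    using * bounded_C0_functions[OF *(2) top]
    by (intro cdual_eqI linfty_functional_in_cdual) (simp_all add: linfty_functional_delta)
  then show "\<phi> \<in> linfty_functional ` C0_functions \<sigma>" using *(2) by (rule image_eqI)
qed (simp_all add: bounded_C0_functions[OF _ top] linfty_functional_in_cdual linfty_functional_delta)

lemma closed_cdual: "closed (cdual :: ('b::complex_banach_algebra \<Rightarrow>\<^sub>L complex) set)"
  unfolding cdual_def by (intro closed_Collect_all closed_Collect_eq continuous_intros)

text \<open>Compactness of preimages of compact sets is what preserves vanishing at infinity; for
  translations it is the hypothesis on the semigroup.\<close>

lemma C0_functions_compose:
  assumes "continuous_map \<sigma> \<sigma> h" "\<And>L. compactin \<sigma> L \<Longrightarrow> compactin \<sigma> {t. h t \<in> L}"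
    and "f \<in> C0_functions \<sigma>"
  shows "(\<lambda>t. f (h t)) \<in> C0_functions \<sigma>"
proof (rule C0_functionsI)
  show "continuous_map \<sigma> euclidean (\<lambda>t. f (h t))"
    using assms(1,3) continuous_map_compose[of \<sigma> \<sigma> h euclidean f]
    by (simp add: C0_functions_def o_def)
  fix e :: real assume "e > 0"
  then have "compactin \<sigma> {t. h t \<in> {s \<in> topspace \<sigma>. e \<le> norm (f s)}}"
    using assms(2,3) unfolding C0_functions_def by blast
  moreover have "h t \<in> topspace \<sigma>" if "t \<in> topspace \<sigma>" for t
    using assms(1) that by (auto simp: continuous_map_def)
  ultimately show "\<exists>K. compactin \<sigma> K \<and> (\<forall>t\<in>topspace \<sigma>. e \<le> norm (f (h t)) \<longrightarrow> t \<in> K)"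
    by blast
qed

lemma has_sum_in_closed:
  fixes f :: "'i \<Rightarrow> 'b::{topological_comm_monoid_add, t2_space}"
  assumes "closed E" "0 \<in> E" "\<And>x y. x \<in> E \<Longrightarrow> y \<in> E \<Longrightarrow> x + y \<in> E"
    and "(f has_sum x) A" "\<And>i. i \<in> A \<Longrightarrow> f i \<in> E"
  shows "x \<in> E"
proof (rule Lim_in_closed_set[OF assms(1)])
  have "sum f X \<in> E" if "finite X" "X \<subseteq> A" for X
    using that by (induction X rule: finite_induct) (simp_all add: assms)
  then show "\<forall>\<^sub>F X in finite_subsets_at_top A. sum f X \<in> E"
    by (intro eventually_finite_subsets_at_top_weakI)
  show "(sum f \<longlongrightarrow> x) (finite_subsets_at_top A)"
    using assms(4) by (simp add: has_sum_def)
qed simp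

text \<open>The action is bounded and linear in \<open>a\<close>, hence commutes with the expansion
  of \<open>a\<close> in the unit vectors. This reduces the module property to translations.\<close>

lemma has_sum_lact:
  fixes \<phi> :: "'a::semigroup_mult ell1 \<Rightarrow>\<^sub>L complex"
  assumes "\<phi> \<in> cdual"
  shows "((\<lambda>s. scale_functional (ell1_apply a s) (lact (delta s) \<phi>)) has_sum lact a \<phi>) UNIV"
proof -
  have "bounded_linear (\<lambda>x. lact x \<phi>)"
    unfolding lact_def
    by (intro bounded_linear_compose[OF bounded_bilinear.bounded_linear_right[OF bounded_bilinear_blinfun_compose]]
        bounded_linear_blinfun_mult_left)
  from has_sum_bounded_linear[OF this delta_has_sum[of a]]
  have "((\<lambda>s. lact (ell1_apply a s *\<^sub>C delta s) \<phi>) has_sum lact a \<phi>) UNIV"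
    by (simp add: o_def)
  moreover have "lact (c *\<^sub>C x) \<phi> = scale_functional c (lact x \<phi>)" for c x
    using assms by (intro blinfun_eqI) (simp add: cdual_def mult_scaleC_right)
  ultimately show ?thesis by simp
qed

lemma has_sum_ract:
  fixes \<phi> :: "'a::semigroup_mult ell1 \<Rightarrow>\<^sub>L complex"
  assumes "\<phi> \<in> cdual"
  shows "((\<lambda>s. scale_functional (ell1_apply a s) (ract \<phi> (delta s))) has_sum ract \<phi> a) UNIV"
proof -
  have "bounded_linear (\<lambda>x. ract \<phi> x)"
    unfolding ract_def
    by (intro bounded_linear_compose[OF bounded_bilinear.bounded_linear_right[OF bounded_bilinear_blinfun_compose]]
        bounded_linear_blinfun_mult_right)
  from has_sum_bounded_linear[OF this delta_has_sum[of a]]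
  have "((\<lambda>s. ract \<phi> (ell1_apply a s *\<^sub>C delta s)) has_sum ract \<phi> a) UNIV"
    by (simp add: o_def)
  moreover have "ract \<phi> (c *\<^sub>C x) = scale_functional c (ract \<phi> x)" for c x
    using assms by (intro blinfun_eqI) (simp add: cdual_def mult_scaleC_left)
  ultimately show ?thesis by simp
qed

lemma closed_C0_functionals:
  fixes \<sigma> :: "'a::semigroup_mult topology"
  assumes top: "topspace \<sigma> = UNIV"
  shows "closed (linfty_functional ` C0_functions \<sigma>)"
proof -
  note iff = C0_functionals_iff[OF top]
  have "\<phi> \<in> linfty_functional ` C0_functions \<sigma>"
    if \<phi>: "\<phi> \<in> closure (linfty_functional ` C0_functions \<sigma>)" for \<phi>
  proof -
    have "linfty_functional ` C0_functions \<sigma> \<subseteq> cdual" using iff by blast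
    then have "\<phi> \<in> cdual" using \<phi> closure_minimal[OF _ closed_cdual] by blast
    moreover have "(\<lambda>s. \<phi> (delta s)) \<in> C0_functions \<sigma>"
    proof (rule C0_functions_uniform_limit)
      fix e :: real assume "e > 0"
      then obtain \<psi> where \<psi>: "\<psi> \<in> linfty_functional ` C0_functions \<sigma>" "dist \<psi> \<phi> < e"
        using \<phi> unfolding closure_approachable by blast
      \<comment> \<open>The unit vectors have norm 1, so closeness in operator norm is uniform
        closeness of the functions.\<close>
      have "norm (\<psi> (delta s) - \<phi> (delta s)) < e" for s
        using norm_blinfun[of "\<psi> - \<phi>" "delta s"] \<psi>(2) by (simp add: dist_norm blinfun.diff_left)
      then show "\<exists>g\<in>C0_functions \<sigma>. \<forall>s\<in>topspace \<sigma>. norm (g s - \<phi> (delta s)) < e"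
        using \<psi>(1) unfolding iff by (intro bexI[of _ "\<lambda>s. \<psi> (delta s)"]) auto
    qed
    ultimately show ?thesis unfolding iff by blast
  qed
  then show ?thesis using closure_subset_eq by blast
qed

lemma sub_bimodule_C0_functionals:
  fixes \<sigma> :: "'a::semigroup_mult topology"
  assumes semi: "semitopological_semigroup \<sigma>"
    and left: "\<And>s L. compactin \<sigma> L \<Longrightarrow> compactin \<sigma> {t. s * t \<in> L}"
    and right: "\<And>s L. compactin \<sigma> L \<Longrightarrow> compactin \<sigma> {t. t * s \<in> L}"
  shows "sub_bimodule (linfty_functional ` C0_functions \<sigma>)"
proof -
  have top: "topspace \<sigma> = UNIV" using semi by (simp add: semitopological_semigroup_def)
  let ?E = "linfty_functional ` C0_functions \<sigma>"
  note iff = C0_functionals_iff[OF top]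
  have sub: "?E \<subseteq> cdual" using iff by blast
  have zero: "0 \<in> ?E"
    unfolding iff by (simp add: cdual_def C0_functions_zero)
  have add: "\<mu> + \<nu> \<in> ?E" if "\<mu> \<in> ?E" "\<nu> \<in> ?E" for \<mu> \<nu>
    using that unfolding iff by (simp add: cdual_def blinfun.add_left C0_functions_add distrib_left)
  have scale: "scale_functional c \<mu> \<in> ?E" if "\<mu> \<in> ?E" for c \<mu>
    using that unfolding iff by (simp add: cdual_def C0_functions_scale mult.left_commute)
  have "lact (delta s) \<mu> \<in> ?E \<and> ract \<mu> (delta s) \<in> ?E" if \<mu>: "\<mu> \<in> ?E" for s \<mu>
  proof -
    obtain f where f: "f \<in> C0_functions \<sigma>" "\<mu> = linfty_functional f" using \<mu> by blast
    have "(\<lambda>t. f (t * s)) \<in> C0_functions \<sigma>" "(\<lambda>t. f (s * t)) \<in> C0_functions \<sigma>"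
      using semi by (auto intro!: C0_functions_compose f(1) left right simp: semitopological_semigroup_def)
    then show ?thesis
      using bounded_C0_functions[OF f(1) top] by (simp add: f(2) lact_delta ract_delta)
  qed
  note delta = this
  \<comment> \<open>Closedness of \<open>?E\<close> carries the property from unit vectors to the
    infinite sums that give the actions of arbitrary elements.\<close>
  have sum_in: "x \<in> ?E"
    if "(f has_sum x) UNIV" "\<And>s. f s \<in> ?E" for f :: "'a \<Rightarrow> _" and x
    by (rule has_sum_in_closed[OF closed_C0_functionals[OF top] zero add that])
  have "lact a \<mu> \<in> ?E \<and> ract \<mu> a \<in> ?E" if \<mu>: "\<mu> \<in> ?E" for a \<mu>
  proof -
    have \<mu>': "\<mu> \<in> cdual" using sub \<mu> by (rule subsetD)
    have "lact a \<mu> \<in> ?E"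
      by (rule sum_in[OF has_sum_lact[OF \<mu>']], rule scale, rule conjunct1[OF delta[OF \<mu>]])
    moreover have "ract \<mu> a \<in> ?E"
      by (rule sum_in[OF has_sum_ract[OF \<mu>']], rule scale, rule conjunct2[OF delta[OF \<mu>]])
    ultimately show ?thesis ..
  qed
  note act = this
  show ?thesis
    unfolding sub_bimodule_def
    by (intro conjI ballI allI sub zero add scale act[THEN conjunct1] act[THEN conjunct2])
qed

section \<open>The canonical map as a surjective isometry\<close>

lemma canonical_map_C0_image:
  fixes \<sigma> :: "'a::semigroup_mult topology"
  assumes top: "topspace \<sigma> = UNIV" and count: "countable (UNIV :: 'a set)"
    and lc: "locally_compact_space \<sigma>" and haus: "Hausdorff_space \<sigma>"
    and mod: "sub_bimodule (linfty_functional ` C0_functions \<sigma>)"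
  shows "canonical_map (linfty_functional ` C0_functions \<sigma>) ` UNIV
    = subspace_dual (linfty_functional ` C0_functions \<sigma>)" (is "canonical_map ?E ` _ = _")
proof (intro equalityI subsetI)
  fix g assume "g \<in> canonical_map ?E ` UNIV"
  then obtain a where g: "g = canonical_map ?E a" by blast
  have "norm (\<mu> a) \<le> norm a * norm \<mu>" for \<mu> :: "'a ell1 \<Rightarrow>\<^sub>L complex"
    using norm_blinfun[of \<mu> a] by (simp add: mult.commute)
  then have "\<exists>K. \<forall>\<mu>\<in>?E. norm (g \<mu>) \<le> K * norm \<mu>"
    unfolding g canonical_map_def by (intro exI[of _ "norm a"]) simp
  then show "g \<in> subspace_dual ?E"
    using mod by (auto simp: subspace_dual_def g canonical_map_def sub_bimodule_def blinfun.add_left)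
next
  fix g assume g: "g \<in> subspace_dual ?E"
  then obtain B where B: "\<And>\<mu>. \<mu> \<in> ?E \<Longrightarrow> norm (g \<mu>) \<le> B * norm \<mu>"
    unfolding subspace_dual_def mem_Collect_eq by (elim conjE exE) blast
  have bdd: "bounded (range f)" if "f \<in> C0_functions \<sigma>" for f
    by (rule bounded_C0_functions[OF that top])
  \<comment> \<open>\<open>mass\<close> of this functional is the preimage of \<open>g\<close>. The
    absolute value supplies the sign needed to replace the norm by its bound
    \<open>r\<close>.\<close>
  interpret C0_functional \<sigma> "\<lambda>f. g (linfty_functional f)" "\<bar>B\<bar>"
  proof
    fix f h assume f: "f \<in> C0_functions \<sigma>" and h: "h \<in> C0_functions \<sigma>"
    have "linfty_functional (\<lambda>s. f s + h s) = linfty_functional f + linfty_functional h"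
      by (rule blinfun_eqI) (simp add: linfty_functional_apply bdd f h C0_functions_add
          blinfun.add_left distrib_right infsum_add abs_summable_summable[OF pairing_abs_summable])
    then show "g (linfty_functional (\<lambda>s. f s + h s)) = g (linfty_functional f) + g (linfty_functional h)"
      using g f h by (simp add: subspace_dual_def)
  next
    fix f and c :: complex assume f: "f \<in> C0_functions \<sigma>"
    have "linfty_functional (\<lambda>s. c * f s) = scale_functional c (linfty_functional f)"
      by (rule blinfun_eqI) (simp add: linfty_functional_apply bdd f C0_functions_scale
          mult.assoc infsum_cmult_right')
    then show "g (linfty_functional (\<lambda>s. c * f s)) = c * g (linfty_functional f)"
      using g f by (simp add: subspace_dual_def)
  next
    fix f r assume f: "f \<in> C0_functions \<sigma>" and r: "\<And>s. norm (f s) \<le> r"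
    have "norm (g (linfty_functional f)) \<le> B * norm (linfty_functional f)"
      using B f by blast
    also have "\<dots> \<le> \<bar>B\<bar> * norm (linfty_functional f)"
      by (intro mult_right_mono) auto
    also have "\<dots> \<le> \<bar>B\<bar> * r"
      unfolding norm_linfty_functional[OF bdd[OF f]]
      by (intro mult_left_mono cSUP_least) (auto simp: r)
    finally show "norm (g (linfty_functional f)) \<le> \<bar>B\<bar> * r" .
  qed (fact top count lc haus)+
  have "g = canonical_map ?E mass"
  proof (rule extensionalityI[of _ ?E])
    fix \<mu> assume "\<mu> \<in> ?E"
    then show "g \<mu> = canonical_map ?E mass \<mu>"
      by (auto simp: canonical_map_def representation linfty_functional_apply bdd)
  qed (use g in \<open>auto simp: subspace_dual_def canonical_map_def\<close>)
  then show "g \<in> canonical_map ?E ` UNIV" by blast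
qed

text \<open>One inequality is the operator norm bound. For the other, \<open>norm_ell1_le_C0\<close>
  is applied with the supremum over the unit ball as constant, which requires scaling each test
  function into the ball.\<close>

lemma canonical_map_C0_isometry:
  fixes \<sigma> :: "'a::semigroup_mult topology"
  assumes top: "topspace \<sigma> = UNIV" and count: "countable (UNIV :: 'a set)"
    and lc: "locally_compact_space \<sigma>" and haus: "Hausdorff_space \<sigma>"
  defines "E \<equiv> linfty_functional ` C0_functions \<sigma>"
  shows "subspace_dual_dist E (canonical_map E x) (canonical_map E y) = dist x y"
proof -
  have bdd: "bounded (range f)" if "f \<in> C0_functions \<sigma>" for f
    by (rule bounded_C0_functions[OF that top])
  let ?B = "{\<mu> \<in> E. norm \<mu> \<le> 1}"
  let ?S = "SUP \<mu>\<in>?B. norm (blinfun_apply \<mu> (x - y))"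
  have le: "norm (\<mu> (x - y)) \<le> norm (x - y)" if "\<mu> \<in> ?B" for \<mu>
    using norm_blinfun[of \<mu> "x - y"] that mult_right_mono[of "norm \<mu>" 1 "norm (x - y)"] by simp
  have upper: "norm (\<mu> (x - y)) \<le> ?S" if "\<mu> \<in> ?B" for \<mu>
    by (rule cSUP_upper[OF that]) (auto intro!: bdd_aboveI2[where M = "norm (x - y)"] le)
  have zero: "0 \<in> ?B"
    unfolding E_def C0_functionals_iff[OF top] mem_Collect_eq
    by (simp add: cdual_def C0_functions_zero)
  have "norm (x - y) \<le> ?S"
  proof (rule norm_ell1_le_C0[OF top count lc haus])
    fix f and r :: real assume f: "f \<in> C0_functions \<sigma>" and r: "\<And>s. norm (f s) \<le> r"
    \<comment> \<open>The scaling divides by \<open>r\<close>, so \<open>r = 0\<close>, which forces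
      \<open>f = 0\<close>, is treated apart.\<close>
    show "norm (\<Sum>\<^sub>\<infinity>s. f s * ell1_apply (x - y) s) \<le> ?S * r"
    proof (cases "r = 0")
      case True
      then have "f s = 0" for s using r[of s] by simp
      then show ?thesis using True by simp
    next
      case False
      then have "r > 0" using order_trans[OF norm_ge_zero r] by (simp add: less_le)
      define h where "h s = of_real (1 / r) * f s" for s
      have h: "h \<in> C0_functions \<sigma>" unfolding h_def by (rule C0_functions_scale[OF f])
      have "norm (h s) \<le> 1" for s
        using r[of s] \<open>r > 0\<close> by (simp add: h_def norm_mult norm_divide divide_le_eq_1)
      then have "linfty_functional h \<in> ?B"
        using h by (auto simp: E_def norm_linfty_functional[OF bdd[OF h]] intro!: cSUP_least)
      from upper[OF this] have "norm (\<Sum>\<^sub>\<infinity>s. h s * ell1_apply (x - y) s) \<le> ?S"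
        by (simp add: linfty_functional_apply bdd[OF h])
      moreover have "(\<Sum>\<^sub>\<infinity>s. h s * ell1_apply (x - y) s)
          = of_real (1 / r) * (\<Sum>\<^sub>\<infinity>s. f s * ell1_apply (x - y) s)"
        unfolding h_def mult.assoc by (rule infsum_cmult_right')
      ultimately show ?thesis
        using \<open>r > 0\<close> by (simp add: norm_mult norm_divide pos_divide_le_eq)
    qed
  qed
  moreover have "?S \<le> norm (x - y)"
    by (rule cSUP_least) (use zero le in auto)
  ultimately have "?S = dist x y" by (simp add: dist_norm)
  moreover have "subspace_dual_dist E (canonical_map E x) (canonical_map E y) = \<bar>?S\<bar>"
    unfolding subspace_dual_dist_def
    by (rule arg_cong[where f = abs], rule SUP_cong)
      (simp_all add: canonical_map_def blinfun.diff_right)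
  ultimately show ?thesis by simp
qed

theorem lemma2p3:
  fixes \<sigma> :: "'a::semigroup_mult topology"
  assumes "countable (UNIV :: 'a set)"
    and "locally_compact_space \<sigma>"
    and "Hausdorff_space \<sigma>"
    and "semitopological_semigroup \<sigma>"
    and "\<And>s L. compactin \<sigma> L \<Longrightarrow> compactin \<sigma> {t. s * t \<in> L}"
    and "\<And>s L. compactin \<sigma> L \<Longrightarrow> compactin \<sigma> {t. t * s \<in> L}"
  shows "is_predual (linfty_functional ` C0_functions \<sigma>)"
proof -
  let ?E = "linfty_functional ` C0_functions \<sigma>"
  have top: "topspace \<sigma> = UNIV" using assms(4) by (simp add: semitopological_semigroup_def)
  have mod: "sub_bimodule ?E" by (rule sub_bimodule_C0_functionals[OF assms(4-6)])
  interpret Metric_space12 UNIV dist "subspace_dual ?E" "subspace_dual_dist ?E"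
    using Met_TC.Metric_space_axioms Metric_space_subspace_dual[OF mod] by (simp add: Metric_space12_def)
  \<comment> \<open>Both topologies are written as metric topologies, between which a surjective
    isometry is a homeomorphism.\<close>
  have "homeomorphic_map euclidean (subspace_dual_topology ?E) (canonical_map ?E)"
    unfolding subspace_dual_topology_def mtopology_is_euclidean[symmetric]
    by (rule isometry_imp_homeomorphic_map[OF canonical_map_C0_image[OF top assms(1-3) mod]
          canonical_map_C0_isometry[OF top assms(1-3)]])
  then show ?thesis
    using mod closed_C0_functionals[OF top] by (simp add: is_predual_def)
qed

end
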